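(* Let $X$ be a locale and $R$ a localic relation on $X$ with open cones that is weakly closed (as a sublocale of $X\times X$). Then $R\cong R_{\Uparrow_R,\Downarrow_R}$ as sublocales of $X\times X$.
   Context: Frames and locales. A frame is a complete lattice (order $\sqsubseteq$) in which $x\wedge\bigvee y_i=\bigvee (x\wedge y_i)$; frame maps preserve finite meets and all joins. The category of locales is the opposite of the category of frames: a locale $X$ has a frame of opens $\mathcal{O}X$, and a map $f\colon X\to Y$ is a frame map $f^{-1}\colon\mathcal{O}Y\to\mathcal{O}X$, with right adjoint $f_\ast$. $L\otimes M$ is the coproduct of frames, generated under joins by the rectangles $x\otimes y=\iota_1(x)\wedge\iota_2(y)$ ($\iota_1,\iota_2$ the coproduct injections); $\mathcal{O}(X\times Y)=\mathcal{O}X\otimes\mathcal{O}Y$. A sublocale of $X$ is (an isomorphism class of) an extremal monomorphism $A\rightarrowtail X$, equivalently a map whose frame map is surjective; $A\subseteq B$ means the inclusion of $A$ factors (uniquely) through that of $B$. Weak closedness. Write $1$ for the terminal locale ($\mathcal{O}1$ is the initial frame, of truth values) and $!_X\colon X\to 1$ for the terminal map. A locale map $f\colon X\to Y$ is strongly dense if $f_\ast(!_X^{-1}(p))\sqsubseteq\, !_Y^{-1}(p)$ for all $p\in\mathcal{O}1$. A sublocale $A$ of $X$ is weakly closed if every strongly dense inclusion $A\subseteq B$ into a sublocale $B$ of $X$ is an isomorphism. Open cone relations. A localic relation on $X$ is a sublocale $r\colon R\rightarrowtail X\times X$; its source and target maps are $s=\mathrm{pr}_1\circ r$, $t=\mathrm{pr}_2\circ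 r\colon R\to X$. A locale map $f\colon X\to Y$ is open if $f^{-1}$ has a left adjoint $f_!$ with $f_!(U\wedge f^{-1}(V))=f_!(U)\wedge V$. $R$ has open cones if $s,t$ are open; then its induced cones are $\Uparrow_R:=t_!s^{-1}$ and $\Downarrow_R:=s_!t^{-1}\colon\mathcal{O}X\to\mathcal{O}X$. These preserve all joins and are parallel in the sense below. Parallel pairs and induced relation. Functions $\mathsf{u},\mathsf{d}\colon L\to L$ on a frame are parallel if $\mathsf{u}(x)\wedge y\sqsubseteq\mathsf{u}(x\wedge\mathsf{d}(y))$ and $x\wedge\mathsf{d}(y)\sqsubseteq\mathsf{d}(\mathsf{u}(x)\wedge y)$ for all $x,y\in L$. Given such a join-preserving pair on $\mathcal{O}X$, let $\sim$ be the binary relation on rectangles of $\mathcal{O}X\otimes\mathcal{O}X$ with $a\otimes b\sim c\otimes d$ iff $\mathsf{u}(a)\wedge b=\mathsf{u}(c)\wedge d$ and $a\wedge\mathsf{d}(b)=c\wedge\mathsf{d}(d)$. An element $o\in\mathcal{O}X\otimes\mathcal{O}X$ is $\sim$-saturated if for all $p\sim q$ and all $w$: $p\wedge w\sqsubseteq o$ iff $q\wedge w\sqsubseteq o$. $R_{\mathsf{u},\mathsf{d}}\rightarrowtail X\times X$ is the sublocale whose frame is the set of $\sim$-saturated elements, with frame map $\mu_\sim(o)=$ the least $\sim$-saturated element above $o$; equivalently, the quotient of $\mathcal{O}X\otimes\mathcal{O}X$ by the frame congruence generated by $\sim$. *)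

theory Defs
  imports "HOL-Algebra.Galois_Connection"
begin

section \<open>Frames and locales\<close>

locale frame = complete_lattice L for L (structure) +
  assumes meet_sup_distrib:
    "\<lbrakk>x \<in> carrier L; A \<subseteq> carrier L\<rbrakk> \<Longrightarrow> x \<sqinter> \<Squnion>A = \<Squnion>((\<lambda>y. x \<sqinter> y) ` A)"

locale frame_map = dom: frame L + cod: frame M
  for L :: "'a gorder" and M :: "'b gorder" and f :: "'a \<Rightarrow> 'b" +
  assumes map_closed: "f \<in> carrier L \<rightarrow> carrier M"
    and map_top: "f \<top>\<^bsub>L\<^esub> = \<top>\<^bsub>M\<^esub>"
    and map_meet: "\<lbrakk>x \<in> carrier L; y \<in> carrier L\<rbrakk> \<Longrightarrow> f (x \<sqinter>\<^bsub>L\<^esub> y) = f x \<sqinter>\<^bsub>M\<^esub> f y"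
    and map_sup: "A \<subseteq> carrier L \<Longrightarrow> f (\<Squnion>\<^bsub>L\<^esub>A) = \<Squnion>\<^bsub>M\<^esub>(f ` A)"

text \<open>
  A locale is represented by its frame of opens, and a map of locales from \<open>X\<close> to \<open>Y\<close> by its
  inverse image map, which is a frame map from \<open>Y\<close> to \<open>X\<close>. Equality of frame maps is equality
  on the carrier.
\<close>

definition frame_iso :: "'a gorder \<Rightarrow> 'b gorder \<Rightarrow> ('a \<Rightarrow> 'b) \<Rightarrow> bool" where
  "frame_iso L M f \<longleftrightarrow> frame_map L M f \<and>
     (\<exists>g. frame_map M L g \<and> (\<forall>x\<in>carrier L. g (f x) = x) \<and> (\<forall>y\<in>carrier M. f (g y) = y))"

text \<open>
  These are the adjoints of \<open>f\<close> whenever it has them; see \<open>upper_by_complete_lattice\<close> and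
  \<open>lower_by_complete_lattice\<close> in \<^locale>\<open>galois_connection\<close>.
\<close>

definition right_adjoint :: "'a gorder \<Rightarrow> 'b gorder \<Rightarrow> ('a \<Rightarrow> 'b) \<Rightarrow> 'b \<Rightarrow> 'a" where
  "right_adjoint L M f y = \<Squnion>\<^bsub>L\<^esub>{x \<in> carrier L. f x \<sqsubseteq>\<^bsub>M\<^esub> y}"

definition left_adjoint :: "'a gorder \<Rightarrow> 'b gorder \<Rightarrow> ('a \<Rightarrow> 'b) \<Rightarrow> 'b \<Rightarrow> 'a" where
  "left_adjoint L M f y = \<Sqinter>\<^bsub>L\<^esub>{x \<in> carrier L. y \<sqsubseteq>\<^bsub>M\<^esub> f x}"

text \<open>Here \<open>f\<close> is the inverse image map of a map of locales from \<open>X\<close> to \<open>Y\<close>.\<close>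

definition open_map :: "'a gorder \<Rightarrow> 'b gorder \<Rightarrow> ('b \<Rightarrow> 'a) \<Rightarrow> bool" where
  "open_map X Y f \<longleftrightarrow> frame_map Y X f \<and>
     (\<exists>g. galois_connection \<lparr>orderA = X, orderB = Y, lower = g, upper = f\<rparr> \<and>
          (\<forall>U\<in>carrier X. \<forall>V\<in>carrier Y. g (U \<sqinter>\<^bsub>X\<^esub> f V) = g U \<sqinter>\<^bsub>Y\<^esub> V))"


section \<open>Sublocales\<close>

definition is_sublocale :: "'a gorder \<Rightarrow> 'b gorder \<Rightarrow> ('a \<Rightarrow> 'b) \<Rightarrow> bool" where
  "is_sublocale X A i \<longleftrightarrow> frame_map X A i \<and> i ` carrier X = carrier A"

text \<open>
  \<open>g\<close> is the inverse image map of the (necessarily unique) factorisation of the inclusion of \<open>A\<close>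
  through that of \<open>B\<close>.
\<close>

definition sublocale_inclusion ::
    "'x gorder \<Rightarrow> 'a gorder \<Rightarrow> ('x \<Rightarrow> 'a) \<Rightarrow> 'b gorder \<Rightarrow> ('x \<Rightarrow> 'b) \<Rightarrow> ('b \<Rightarrow> 'a) \<Rightarrow> bool" where
  "sublocale_inclusion X A i B j g \<longleftrightarrow>
     is_sublocale X A i \<and> is_sublocale X B j \<and>
     frame_map B A g \<and> (\<forall>x\<in>carrier X. g (j x) = i x)"

definition sublocale_iso ::
    "'x gorder \<Rightarrow> 'a gorder \<Rightarrow> ('x \<Rightarrow> 'a) \<Rightarrow> 'b gorder \<Rightarrow> ('x \<Rightarrow> 'b) \<Rightarrow> bool" where
  "sublocale_iso X A i B j \<longleftrightarrow> (\<exists>g. sublocale_inclusion X A i B j g \<and> frame_iso B A g)"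

definition truth_values :: "bool gorder" where
  "truth_values = \<lparr>carrier = UNIV, eq = (=), le = (\<longrightarrow>)\<rparr>"

text \<open>
  \<open>bang X\<close> is the inverse image map of the unique map from \<open>X\<close> to the terminal locale, that is,
  the unique frame map from \<open>truth_values\<close> to \<open>X\<close>; see \<open>truth_values_initial\<close>.
\<close>

definition bang :: "'a gorder \<Rightarrow> bool \<Rightarrow> 'a" where
  "bang X p = \<Squnion>\<^bsub>X\<^esub>{x. x = \<top>\<^bsub>X\<^esub> \<and> p}"

definition strongly_dense :: "'a gorder \<Rightarrow> 'b gorder \<Rightarrow> ('b \<Rightarrow> 'a) \<Rightarrow> bool" where
  "strongly_dense X Y f \<longleftrightarrow> frame_map Y X f \<and>
     (\<forall>p\<in>carrier truth_values. right_adjoint Y X f (bang X p) \<sqsubseteq>\<^bsub>Y\<^esub> bang Y p)"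

text \<open>
  The sublocales \<open>B\<close> range over frames on the type underlying \<open>X\<close>. This is no restriction, because
  the frame of a sublocale of \<open>X\<close> is isomorphic to one carried by a subset of \<open>X\<close>; see
  \<open>weakly_closed_any_type\<close> below.
\<close>

definition weakly_closed :: "'x gorder \<Rightarrow> 'a gorder \<Rightarrow> ('x \<Rightarrow> 'a) \<Rightarrow> bool" where
  "weakly_closed X A i \<longleftrightarrow> is_sublocale X A i \<and>
     (\<forall>(B :: 'x gorder) j g.
        sublocale_inclusion X A i B j g \<and> strongly_dense A B g \<longrightarrow> frame_iso B A g)"


section \<open>Coproducts of frames\<close>

text \<open>
  The coproduct of \<open>L\<close> and \<open>M\<close> is realised by the down-closed subsets of \<open>L \<times> M\<close> that are closed
  under (possibly empty) joins in each coordinate; such a set stands for the join of the rectangles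
  \<open>x \<otimes> y\<close> with \<open>(x, y)\<close> in it. See \<open>coprod_exists\<close> and \<open>coprod_unique\<close> for the universal property,
  and \<open>sup_rects\<close> for generation by rectangles.
\<close>

definition biideal :: "'a gorder \<Rightarrow> 'b gorder \<Rightarrow> ('a \<times> 'b) set \<Rightarrow> bool" where
  "biideal L M I \<longleftrightarrow> I \<subseteq> carrier L \<times> carrier M \<and>
     (\<forall>(x, y)\<in>I. \<forall>x'\<in>carrier L. \<forall>y'\<in>carrier M.
        x' \<sqsubseteq>\<^bsub>L\<^esub> x \<longrightarrow> y' \<sqsubseteq>\<^bsub>M\<^esub> y \<longrightarrow> (x', y') \<in> I) \<and>
     (\<forall>A y. A \<subseteq> carrier L \<longrightarrow> y \<in> carrier M \<longrightarrow> (\<forall>x\<in>A. (x, y) \<in> I) \<longrightarrow> (\<Squnion>\<^bsub>L\<^esub>A, y) \<in> I) \<and>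
     (\<forall>x B. x \<in> carrier L \<longrightarrow> B \<subseteq> carrier M \<longrightarrow> (\<forall>y\<in>B. (x, y) \<in> I) \<longrightarrow> (x, \<Squnion>\<^bsub>M\<^esub>B) \<in> I)"

definition coprod :: "'a gorder \<Rightarrow> 'b gorder \<Rightarrow> ('a \<times> 'b) set gorder" where
  "coprod L M = \<lparr>carrier = {I. biideal L M I}, eq = (=), le = (\<subseteq>)\<rparr>"

definition inj1 :: "'a gorder \<Rightarrow> 'b gorder \<Rightarrow> 'a \<Rightarrow> ('a \<times> 'b) set" where
  "inj1 L M x = {(a, b) \<in> carrier L \<times> carrier M. a \<sqsubseteq>\<^bsub>L\<^esub> x \<or> b = \<bottom>\<^bsub>M\<^esub>}"

definition inj2 :: "'a gorder \<Rightarrow> 'b gorder \<Rightarrow> 'b \<Rightarrow> ('a \<times> 'b) set" where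
  "inj2 L M y = {(a, b) \<in> carrier L \<times> carrier M. a = \<bottom>\<^bsub>L\<^esub> \<or> b \<sqsubseteq>\<^bsub>M\<^esub> y}"

definition rect :: "'a gorder \<Rightarrow> 'b gorder \<Rightarrow> 'a \<Rightarrow> 'b \<Rightarrow> ('a \<times> 'b) set" where
  "rect L M x y = inj1 L M x \<sqinter>\<^bsub>coprod L M\<^esub> inj2 L M y"


section \<open>Open cone relations\<close>

text \<open>\<open>coprod X X\<close> is the frame of opens of the product locale \<open>X \<times> X\<close>.\<close>

definition localic_relation ::
    "'a gorder \<Rightarrow> 'r gorder \<Rightarrow> (('a \<times> 'a) set \<Rightarrow> 'r) \<Rightarrow> bool" where
  "localic_relation X R r \<longleftrightarrow> is_sublocale (coprod X X) R r"

definition source :: "'a gorder \<Rightarrow> (('a \<times> 'a) set \<Rightarrow> 'r) \<Rightarrow> 'a \<Rightarrow> 'r" where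
  "source X r = r \<circ> inj1 X X"

definition target :: "'a gorder \<Rightarrow> (('a \<times> 'a) set \<Rightarrow> 'r) \<Rightarrow> 'a \<Rightarrow> 'r" where
  "target X r = r \<circ> inj2 X X"

definition open_cones :: "'a gorder \<Rightarrow> 'r gorder \<Rightarrow> (('a \<times> 'a) set \<Rightarrow> 'r) \<Rightarrow> bool" where
  "open_cones X R r \<longleftrightarrow> open_map R X (source X r) \<and> open_map R X (target X r)"

definition up_cone :: "'a gorder \<Rightarrow> 'r gorder \<Rightarrow> (('a \<times> 'a) set \<Rightarrow> 'r) \<Rightarrow> 'a \<Rightarrow> 'a" where
  "up_cone X R r = left_adjoint X R (target X r) \<circ> source X r"

definition down_cone :: "'a gorder \<Rightarrow> 'r gorder \<Rightarrow> (('a \<times> 'a) set \<Rightarrow> 'r) \<Rightarrow> 'a \<Rightarrow> 'a" where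
  "down_cone X R r = left_adjoint X R (source X r) \<circ> target X r"


section \<open>The relation induced by a parallel pair\<close>

definition parallel :: "'a gorder \<Rightarrow> ('a \<Rightarrow> 'a) \<Rightarrow> ('a \<Rightarrow> 'a) \<Rightarrow> bool" where
  "parallel L u d \<longleftrightarrow> (\<forall>x\<in>carrier L. \<forall>y\<in>carrier L.
     u x \<sqinter>\<^bsub>L\<^esub> y \<sqsubseteq>\<^bsub>L\<^esub> u (x \<sqinter>\<^bsub>L\<^esub> d y) \<and> x \<sqinter>\<^bsub>L\<^esub> d y \<sqsubseteq>\<^bsub>L\<^esub> d (u x \<sqinter>\<^bsub>L\<^esub> y))"

definition rect_sim ::
    "'a gorder \<Rightarrow> ('a \<Rightarrow> 'a) \<Rightarrow> ('a \<Rightarrow> 'a) \<Rightarrow> ('a \<times> 'a) set \<Rightarrow> ('a \<times> 'a) set \<Rightarrow> bool" where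
  "rect_sim X u d p q \<longleftrightarrow>
     (\<exists>a\<in>carrier X. \<exists>b\<in>carrier X. \<exists>c\<in>carrier X. \<exists>e\<in>carrier X.
        p = rect X X a b \<and> q = rect X X c e \<and>
        u a \<sqinter>\<^bsub>X\<^esub> b = u c \<sqinter>\<^bsub>X\<^esub> e \<and> a \<sqinter>\<^bsub>X\<^esub> d b = c \<sqinter>\<^bsub>X\<^esub> d e)"

definition sim_saturated ::
    "'a gorder \<Rightarrow> ('a \<Rightarrow> 'a) \<Rightarrow> ('a \<Rightarrow> 'a) \<Rightarrow> ('a \<times> 'a) set \<Rightarrow> bool" where
  "sim_saturated X u d z \<longleftrightarrow> z \<in> carrier (coprod X X) \<and>
     (\<forall>p q. rect_sim X u d p q \<longrightarrow> (\<forall>w\<in>carrier (coprod X X).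
        p \<sqinter>\<^bsub>coprod X X\<^esub> w \<sqsubseteq>\<^bsub>coprod X X\<^esub> z \<longleftrightarrow> q \<sqinter>\<^bsub>coprod X X\<^esub> w \<sqsubseteq>\<^bsub>coprod X X\<^esub> z))"

definition induced_rel :: "'a gorder \<Rightarrow> ('a \<Rightarrow> 'a) \<Rightarrow> ('a \<Rightarrow> 'a) \<Rightarrow> ('a \<times> 'a) set gorder" where
  "induced_rel X u d = (coprod X X)\<lparr>carrier := {z. sim_saturated X u d z}\<rparr>"

definition induced_map ::
    "'a gorder \<Rightarrow> ('a \<Rightarrow> 'a) \<Rightarrow> ('a \<Rightarrow> 'a) \<Rightarrow> ('a \<times> 'a) set \<Rightarrow> ('a \<times> 'a) set" where
  "induced_map X u d w = (SOME z. least (coprod X X) z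
     {z. sim_saturated X u d z \<and> w \<sqsubseteq>\<^bsub>coprod X X\<^esub> z})"


section \<open>Consistency of the representation\<close>

context frame
begin

lemma top_eq: "t \<in> carrier L \<Longrightarrow> (\<And>x. x \<in> carrier L \<Longrightarrow> x \<sqsubseteq> t) \<Longrightarrow> t = \<top>"
  by (metis le_antisym top_closed top_higher)

lemma bottom_eq: "b \<in> carrier L \<Longrightarrow> (\<And>x. x \<in> carrier L \<Longrightarrow> b \<sqsubseteq> x) \<Longrightarrow> b = \<bottom>"
  by (metis le_antisym bottom_closed bottom_lower)

lemma meet_le_iff:
  assumes "x \<in> carrier L" "y \<in> carrier L" "z \<in> carrier L"
  shows "z \<sqsubseteq> x \<sqinter> y \<longleftrightarrow> z \<sqsubseteq> x \<and> z \<sqsubseteq> y"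
  by (meson assms le_trans meet_closed meet_le meet_left meet_right)

lemma sup_le_iff:
  assumes "A \<subseteq> carrier L" "z \<in> carrier L"
  shows "\<Squnion>A \<sqsubseteq> z \<longleftrightarrow> (\<forall>x\<in>A. x \<sqsubseteq> z)"
  by (meson assms le_trans sup_closed sup_least sup_upper subsetD)

lemma sup_eqI:
  assumes "A \<subseteq> carrier L" "z \<in> carrier L" "\<And>x. x \<in> A \<Longrightarrow> x \<sqsubseteq> z"
    and "\<And>w. w \<in> carrier L \<Longrightarrow> (\<And>x. x \<in> A \<Longrightarrow> x \<sqsubseteq> w) \<Longrightarrow> z \<sqsubseteq> w"
  shows "\<Squnion>A = z"
  using assms by (intro le_antisym) (auto simp: sup_le_iff sup_upper)

lemma inf_eqI:
  assumes "A \<subseteq> carrier L" "z \<in> carrier L" "\<And>x. x \<in> A \<Longrightarrow> z \<sqsubseteq> x"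
    and "\<And>w. w \<in> carrier L \<Longrightarrow> (\<And>x. x \<in> A \<Longrightarrow> w \<sqsubseteq> x) \<Longrightarrow> w \<sqsubseteq> z"
  shows "\<Sqinter>A = z"
  using assms by (intro le_antisym) (simp_all add: inf_greatest inf_lower)

lemma meet_eqI:
  assumes "x \<in> carrier L" "y \<in> carrier L" "z \<in> carrier L"
    and "\<And>w. w \<in> carrier L \<Longrightarrow> w \<sqsubseteq> z \<longleftrightarrow> w \<sqsubseteq> x \<and> w \<sqsubseteq> y"
  shows "x \<sqinter> y = z"
  using assms by (intro le_antisym) (auto simp: meet_le_iff meet_left meet_right)

end

lemma (in complete_lattice) frameI:
  assumes "\<And>x A z. \<lbrakk>x \<in> carrier L; A \<subseteq> carrier L; z \<in> carrier L;
    \<And>y. y \<in> A \<Longrightarrow> x \<sqinter> y \<sqsubseteq> z\<rbrakk> \<Longrightarrow> x \<sqinter> \<Squnion>A \<sqsubseteq> z"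
  shows "frame L"
proof (unfold_locales)
  fix x A
  assume xA: "x \<in> carrier L" "A \<subseteq> carrier L"
  have c: "(\<lambda>y. x \<sqinter> y) ` A \<subseteq> carrier L" "\<Squnion>A \<in> carrier L" "x \<sqinter> \<Squnion>A \<in> carrier L"
    using xA by auto
  show "x \<sqinter> \<Squnion>A = \<Squnion>((\<lambda>y. x \<sqinter> y) ` A)"
  proof (rule le_antisym)
    show "x \<sqinter> \<Squnion>A \<sqsubseteq> \<Squnion>((\<lambda>y. x \<sqinter> y) ` A)"
      by (rule assms) (use xA c in \<open>auto intro!: sup_upper\<close>)
    have "x \<sqinter> y \<sqsubseteq> x \<sqinter> \<Squnion>A" if "y \<in> A" for y
    proof (rule meet_le)
      have y: "y \<in> carrier L" using that xA by auto
      show "x \<sqinter> y \<sqsubseteq> x" using xA y by (simp add: meet_left)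
      show "x \<sqinter> y \<sqsubseteq> \<Squnion>A"
        by (rule le_trans[of _ y]) (use xA y c that in \<open>auto simp: meet_right sup_upper\<close>)
    qed (use xA c that in auto)
    then show "\<Squnion>((\<lambda>y. x \<sqinter> y) ` A) \<sqsubseteq> x \<sqinter> \<Squnion>A"
      by (intro sup_least) (use c in auto)
  qed (use xA c in auto)
qed

context frame_map
begin

lemma closed [simp]: "x \<in> carrier L \<Longrightarrow> f x \<in> carrier M"
  using map_closed by auto

lemma mono:
  assumes "x \<in> carrier L" "y \<in> carrier L" "x \<sqsubseteq>\<^bsub>L\<^esub> y"
  shows "f x \<sqsubseteq>\<^bsub>M\<^esub> f y"
proof -
  have "x \<sqinter>\<^bsub>L\<^esub> y = x"
    using assms by (intro dom.meet_eqI) (auto intro: dom.le_trans)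
  then have "f x = f x \<sqinter>\<^bsub>M\<^esub> f y"
    using map_meet[of x y] assms by simp
  then show ?thesis
    using assms by (metis closed cod.meet_right)
qed

lemma map_bottom: "f \<bottom>\<^bsub>L\<^esub> = \<bottom>\<^bsub>M\<^esub>"
proof -
  have "\<Squnion>\<^bsub>L\<^esub>{} = \<bottom>\<^bsub>L\<^esub>" "\<Squnion>\<^bsub>M\<^esub>{} = \<bottom>\<^bsub>M\<^esub>"
    by (auto intro!: dom.sup_eqI cod.sup_eqI)
  then show ?thesis
    using map_sup[of "{}"] by simp
qed

lemma right_adjoint:
  assumes "x \<in> carrier L" "y \<in> carrier M"
  shows "f x \<sqsubseteq>\<^bsub>M\<^esub> y \<longleftrightarrow> x \<sqsubseteq>\<^bsub>L\<^esub> right_adjoint L M f y"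
proof
  assume "f x \<sqsubseteq>\<^bsub>M\<^esub> y"
  then show "x \<sqsubseteq>\<^bsub>L\<^esub> right_adjoint L M f y"
    using assms unfolding right_adjoint_def by (intro dom.sup_upper) auto
next
  assume *: "x \<sqsubseteq>\<^bsub>L\<^esub> right_adjoint L M f y"
  let ?S = "{x \<in> carrier L. f x \<sqsubseteq>\<^bsub>M\<^esub> y}"
  have S: "\<Squnion>\<^bsub>L\<^esub>?S \<in> carrier L"
    by (rule dom.sup_closed) auto
  have 1: "f x \<sqsubseteq>\<^bsub>M\<^esub> f (\<Squnion>\<^bsub>L\<^esub>?S)"
    using * assms S by (intro mono) (auto simp: right_adjoint_def)
  have "f (\<Squnion>\<^bsub>L\<^esub>?S) = \<Squnion>\<^bsub>M\<^esub>(f ` ?S)"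
    by (rule map_sup) auto
  also have "\<dots> \<sqsubseteq>\<^bsub>M\<^esub> y"
    using assms by (intro cod.sup_least) auto
  finally show "f x \<sqsubseteq>\<^bsub>M\<^esub> y"
    using 1 assms S by (meson cod.le_trans closed)
qed

end

lemma frame_mapI:
  assumes "frame L" "frame M" "f \<in> carrier L \<rightarrow> carrier M" "f \<top>\<^bsub>L\<^esub> = \<top>\<^bsub>M\<^esub>"
    and "\<And>x y. \<lbrakk>x \<in> carrier L; y \<in> carrier L\<rbrakk> \<Longrightarrow> f (x \<sqinter>\<^bsub>L\<^esub> y) = f x \<sqinter>\<^bsub>M\<^esub> f y"
    and "\<And>A. A \<subseteq> carrier L \<Longrightarrow> f (\<Squnion>\<^bsub>L\<^esub>A) = \<Squnion>\<^bsub>M\<^esub>(f ` A)"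
  shows "frame_map L M f"
  using assms by (simp add: frame_map_def frame_map_axioms_def)

lemma order_iso_frame_map:
  assumes "frame L" "frame M" "bij_betw f (carrier L) (carrier M)"
    and le: "\<And>x y. \<lbrakk>x \<in> carrier L; y \<in> carrier L\<rbrakk> \<Longrightarrow> f x \<sqsubseteq>\<^bsub>M\<^esub> f y \<longleftrightarrow> x \<sqsubseteq>\<^bsub>L\<^esub> y"
  shows "frame_map L M f"
proof -
  interpret L: frame L by fact
  interpret M: frame M by fact
  have im: "f ` carrier L = carrier M" using assms(3) by (simp add: bij_betw_def)
  have cl [simp]: "x \<in> carrier L \<Longrightarrow> f x \<in> carrier M" for x using im by auto
  have M: "\<exists>x\<in>carrier L. w = f x" if "w \<in> carrier M" for w using im that by auto
  show ?thesis
  proof (rule frame_mapI)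
    show "f \<top>\<^bsub>L\<^esub> = \<top>\<^bsub>M\<^esub>"
      by (rule M.top_eq) (auto dest!: M simp: le)
    show "f (x \<sqinter>\<^bsub>L\<^esub> y) = f x \<sqinter>\<^bsub>M\<^esub> f y" if "x \<in> carrier L" "y \<in> carrier L" for x y
      by (rule M.meet_eqI[symmetric]) (use that in \<open>auto dest!: M simp: le L.meet_le_iff\<close>)
    show "f (\<Squnion>\<^bsub>L\<^esub>A) = \<Squnion>\<^bsub>M\<^esub>(f ` A)" if A: "A \<subseteq> carrier L" for A
    proof (rule M.sup_eqI[symmetric])
      have [simp]: "x \<in> A \<Longrightarrow> x \<in> carrier L" for x using A by auto
      show "f ` A \<subseteq> carrier M" "f (\<Squnion>\<^bsub>L\<^esub>A) \<in> carrier M" using A by auto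
      show "x \<sqsubseteq>\<^bsub>M\<^esub> f (\<Squnion>\<^bsub>L\<^esub>A)" if "x \<in> f ` A" for x
        using that A by (auto simp: le L.sup_upper)
      show "f (\<Squnion>\<^bsub>L\<^esub>A) \<sqsubseteq>\<^bsub>M\<^esub> w" if "w \<in> carrier M" "\<And>x. x \<in> f ` A \<Longrightarrow> x \<sqsubseteq>\<^bsub>M\<^esub> w" for w
        using M[OF that(1)] that(2) A by (auto simp: le L.sup_le_iff) (metis imageI le subsetD)
    qed
  qed (use assms in auto)
qed

lemma frame_map_comp:
  assumes "frame_map L M f" "frame_map M N g"
  shows "frame_map L N (g \<circ> f)"
proof -
  interpret f: frame_map L M f by fact
  interpret g: frame_map M N g by fact
  show ?thesis
    by (rule frame_mapI)
       (auto simp: f.dom.frame_axioms g.cod.frame_axioms f.map_top g.map_top f.map_meet g.map_meet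
         f.map_sup g.map_sup image_comp image_subset_iff subset_eq)
qed

lemma truth_values_frame: "frame truth_values"
proof -
  interpret partial_order truth_values
    by unfold_locales (auto simp: truth_values_def)
  have "complete_lattice truth_values"
  proof (rule complete_latticeI)
    fix A :: "bool set"
    have "least truth_values (\<exists>x\<in>A. x) (Upper truth_values A)"
      by (auto simp: least_def Upper_def truth_values_def)
    then show "\<exists>s. least truth_values s (Upper truth_values A)" ..
    have "greatest truth_values (\<forall>x\<in>A. x) (Lower truth_values A)"
      by (auto simp: greatest_def Lower_def truth_values_def)
    then show "\<exists>s. greatest truth_values s (Lower truth_values A)" ..
  qed
  then interpret complete_lattice truth_values .
  have S: "\<Squnion>\<^bsub>truth_values\<^esub>A \<longleftrightarrow> (\<exists>x\<in>A. x)" for A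
    using sup_lub[of A] by (auto simp: least_def Upper_def truth_values_def)
  have I: "x \<sqinter>\<^bsub>truth_values\<^esub> y \<longleftrightarrow> x \<and> y" for x y
    using inf_glb[of "{x, y}"]
    by (auto simp: meet_def greatest_def Lower_def truth_values_def)
  show ?thesis
    by (rule frameI) (auto simp: S I, auto simp: truth_values_def)
qed

lemma truth_values_sup: "\<Squnion>\<^bsub>truth_values\<^esub>A \<longleftrightarrow> (\<exists>x\<in>A. x)"
proof -
  interpret frame truth_values by (rule truth_values_frame)
  show ?thesis
    using sup_lub[of A] by (auto simp: least_def Upper_def truth_values_def)
qed

lemma truth_values_meet: "x \<sqinter>\<^bsub>truth_values\<^esub> y \<longleftrightarrow> x \<and> y"
proof -
  interpret frame truth_values by (rule truth_values_frame)
  show ?thesis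
    using inf_glb[of "{x, y}"]
    by (auto simp: meet_def greatest_def Lower_def truth_values_def)
qed

lemma truth_values_top: "\<top>\<^bsub>truth_values\<^esub> = True"
proof -
  interpret frame truth_values by (rule truth_values_frame)
  show ?thesis
    by (rule top_eq[symmetric]) (auto simp: truth_values_def)
qed

lemma truth_values_initial:
  assumes "frame X"
  shows "frame_map truth_values X (bang X)"
    and "frame_map truth_values X f \<Longrightarrow> f = bang X"
proof -
  interpret X: frame X by fact
  have T: "bang X True = \<top>\<^bsub>X\<^esub>" and F: "bang X False = \<bottom>\<^bsub>X\<^esub>"
    unfolding bang_def by (auto intro!: X.sup_eqI)
  have car: "carrier truth_values = UNIV" by (simp add: truth_values_def)
  have bt: "bang X p = (if p then \<top>\<^bsub>X\<^esub> else \<bottom>\<^bsub>X\<^esub>)" for p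
    by (simp add: T F)
  show "frame_map truth_values X (bang X)"
  proof (rule frame_mapI)
    show "bang X (x \<sqinter>\<^bsub>truth_values\<^esub> y) = bang X x \<sqinter>\<^bsub>X\<^esub> bang X y" for x y
      by (rule X.meet_eqI[symmetric])
        (auto simp: bt truth_values_meet intro: X.le_trans[OF _ X.bottom_lower])
    show "bang X (\<Squnion>\<^bsub>truth_values\<^esub>A) = \<Squnion>\<^bsub>X\<^esub>(bang X ` A)" for A
      by (rule X.sup_eqI[symmetric]) (auto simp: bt truth_values_sup)
  qed (auto simp: bt truth_values_top truth_values_frame assms)
  assume "frame_map truth_values X f"
  then interpret f: frame_map truth_values X f .
  have "f True = \<top>\<^bsub>X\<^esub>" using f.map_top by (simp add: truth_values_top)
  moreover have "\<bottom>\<^bsub>truth_values\<^esub> = False"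
    by (rule f.dom.bottom_eq[symmetric]) (auto simp: truth_values_def)
  then have "f False = \<bottom>\<^bsub>X\<^esub>" using f.map_bottom by simp
  ultimately show "f = bang X"
    by (intro ext) (auto simp: bt)
qed

subsection \<open>Frames of closed subsets\<close>

text \<open>
  A subset of a frame closed under meets and under Heyting implication is the frame of a sublocale.
\<close>

locale sublocale_set = frame L for L :: "'a gorder" (structure) +
  fixes S :: "'a set"
  assumes S_carrier: "S \<subseteq> carrier L"
    and S_Inf: "A \<subseteq> S \<Longrightarrow> \<Sqinter>A \<in> S"
    and S_imp: "\<lbrakk>s \<in> S; w \<in> carrier L\<rbrakk> \<Longrightarrow>
      \<exists>i\<in>S. \<forall>v\<in>carrier L. v \<sqsubseteq> i \<longleftrightarrow> v \<sqinter> w \<sqsubseteq> s"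
begin

abbreviation "N \<equiv> L\<lparr>carrier := S\<rparr>"

definition cl :: "'a \<Rightarrow> 'a" where
  "cl w = (SOME z. least L z {z \<in> S. w \<sqsubseteq> z})"

lemma S_closed [simp]: "s \<in> S \<Longrightarrow> s \<in> carrier L"
  using S_carrier by auto

lemma cl_least:
  assumes "w \<in> carrier L" shows "least L (cl w) {z \<in> S. w \<sqsubseteq> z}"
proof -
  have "least L (\<Sqinter>{z \<in> S. w \<sqsubseteq> z}) {z \<in> S. w \<sqsubseteq> z}"
    unfolding least_def using assms by (auto intro!: S_Inf inf_lower inf_greatest)
  then show ?thesis unfolding cl_def by (rule someI)
qed

lemma cl_in [simp]: "w \<in> carrier L \<Longrightarrow> cl w \<in> S"
  using cl_least[of w] by (auto simp: least_def)

lemma cl_le_iff: "w \<in> carrier L \<Longrightarrow> s \<in> S \<Longrightarrow> cl w \<sqsubseteq> s \<longleftrightarrow> w \<sqsubseteq> s"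
  using cl_least[of w] unfolding least_def by (auto intro: le_trans)

lemma le_cl: "w \<in> carrier L \<Longrightarrow> w \<sqsubseteq> cl w"
  using cl_least[of w] by (auto simp: least_def)

lemma cl_id: "s \<in> S \<Longrightarrow> cl s = s"
  by (intro le_antisym) (auto simp: cl_le_iff le_cl)

lemma meet_in: "s \<in> S \<Longrightarrow> t \<in> S \<Longrightarrow> s \<sqinter> t \<in> S"
  unfolding meet_def by (rule S_Inf) auto

lemma top_in: "\<top> \<in> S"
proof -
  have "\<Sqinter>{} = \<top>" by (rule inf_eqI) auto
  then show ?thesis using S_Inf[of "{}"] by simp
qed

lemma meet_cl_le:
  assumes "v \<in> carrier L" "w \<in> carrier L" "s \<in> S"
  shows "v \<sqinter> cl w \<sqsubseteq> s \<longleftrightarrow> v \<sqinter> w \<sqsubseteq> s"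
proof -
  obtain i where i: "i \<in> S" "\<forall>x\<in>carrier L. x \<sqsubseteq> i \<longleftrightarrow> x \<sqinter> v \<sqsubseteq> s"
    using S_imp[OF assms(3) assms(1)] by blast
  then have i': "x \<sqsubseteq> i \<longleftrightarrow> v \<sqinter> x \<sqsubseteq> s" if "x \<in> carrier L" for x
    using that by (metis meet_comm)
  have "v \<sqinter> cl w \<sqsubseteq> s \<longleftrightarrow> cl w \<sqsubseteq> i" using i' assms by simp
  also have "\<dots> \<longleftrightarrow> w \<sqsubseteq> i" using i(1) assms by (simp add: cl_le_iff)
  also have "\<dots> \<longleftrightarrow> v \<sqinter> w \<sqsubseteq> s" using i' assms by simp
  finally show ?thesis .
qed

lemma N_lattice: "complete_lattice N"
proof -
  interpret N: partial_order N
    by unfold_locales (auto simp: eq_is_equal intro: le_trans)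
  show ?thesis
  proof (rule N.complete_latticeI)
    fix A assume A: "A \<subseteq> carrier N"
    then have AL: "A \<subseteq> carrier L" by auto
    have "least N (cl (\<Squnion>A)) (Upper N A)"
      using A AL by (auto simp: least_def Upper_def cl_le_iff sup_le_iff)
        (meson AL S_closed cl_in le_cl le_trans subsetD sup_closed sup_upper)
    then show "\<exists>s. least N s (Upper N A)" ..
    have "greatest N (\<Sqinter>A) (Lower N A)"
      using A AL by (auto simp: greatest_def Lower_def S_Inf inf_lower intro!: inf_greatest)
    then show "\<exists>s. greatest N s (Lower N A)" ..
  qed
qed

lemma N_sup: assumes "A \<subseteq> S" shows "\<Squnion>\<^bsub>N\<^esub>A = cl (\<Squnion>A)"
proof -
  interpret N: complete_lattice N by (rule N_lattice)
  have AL: "A \<subseteq> carrier L" using assms by auto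
  have "least N (cl (\<Squnion>A)) (Upper N A)"
    using assms AL by (auto simp: least_def Upper_def cl_le_iff sup_le_iff)
      (meson AL S_closed cl_in le_cl le_trans subsetD sup_closed sup_upper)
  moreover have "least N (\<Squnion>\<^bsub>N\<^esub>A) (Upper N A)"
    using assms by (intro N.sup_lub) simp
  ultimately show ?thesis
    using N.weak_least_unique N.eq_is_equal by metis
qed

lemma N_meet: assumes "s \<in> S" "t \<in> S" shows "s \<sqinter>\<^bsub>N\<^esub> t = s \<sqinter> t"
proof -
  interpret N: complete_lattice N by (rule N_lattice)
  show ?thesis
  proof (rule N.le_antisym)
    have c: "s \<sqinter>\<^bsub>N\<^esub> t \<in> S"
      using N.meet_closed[of s t] assms by simp
    show "s \<sqinter>\<^bsub>N\<^esub> t \<sqsubseteq>\<^bsub>N\<^esub> s \<sqinter> t"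
      using c assms N.meet_left[of s t] N.meet_right[of s t] by (auto simp: meet_le_iff)
    show "s \<sqinter> t \<sqsubseteq>\<^bsub>N\<^esub> s \<sqinter>\<^bsub>N\<^esub> t"
      using assms by (intro N.meet_le) (auto simp: meet_left meet_right meet_in)
    show "s \<sqinter>\<^bsub>N\<^esub> t \<in> carrier N" "s \<sqinter> t \<in> carrier N"
      using c assms by (auto simp: meet_in)
  qed
qed

lemma N_frame: "frame N"
proof -
  interpret N: complete_lattice N by (rule N_lattice)
  show ?thesis
  proof (rule N.frameI)
    fix x A z
    assume *: "x \<in> carrier N" "A \<subseteq> carrier N" "z \<in> carrier N"
      "\<And>y. y \<in> A \<Longrightarrow> x \<sqinter>\<^bsub>N\<^esub> y \<sqsubseteq>\<^bsub>N\<^esub> z"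
    have A: "A \<subseteq> S" "A \<subseteq> carrier L" using * by auto
    have y: "x \<sqinter> y \<sqsubseteq> z" if "y \<in> A" for y
      using *(4)[OF that] * that by (auto simp: N_meet subset_iff)
    have m: "(\<lambda>y. x \<sqinter> y) ` A \<subseteq> carrier L"
      using * A by auto
    have "x \<sqinter> \<Squnion>A = \<Squnion>((\<lambda>y. x \<sqinter> y) ` A)"
      by (rule meet_sup_distrib) (use * A in auto)
    also have "\<dots> \<sqsubseteq> z"
      using * y m by (subst sup_le_iff) auto
    finally show "x \<sqinter>\<^bsub>N\<^esub> \<Squnion>\<^bsub>N\<^esub>A \<sqsubseteq>\<^bsub>N\<^esub> z"
      using * A by (simp add: N_sup N_meet meet_cl_le)
  qed
qed

lemma cl_sublocale: "is_sublocale L N cl"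
proof -
  interpret N: frame N by (rule N_frame)
  have "frame_map L N cl"
  proof (rule frame_mapI)
    show "cl \<top>\<^bsub>L\<^esub> = \<top>\<^bsub>N\<^esub>"
      by (rule N.top_eq) (auto simp: top_in cl_id)
    show "cl (x \<sqinter> y) = cl x \<sqinter>\<^bsub>N\<^esub> cl y" if xy: "x \<in> carrier L" "y \<in> carrier L" for x y
    proof (rule N.le_antisym)
      show "cl (x \<sqinter> y) \<sqsubseteq>\<^bsub>N\<^esub> cl x \<sqinter>\<^bsub>N\<^esub> cl y"
        using xy by (simp add: N_meet cl_le_iff meet_in meet_le_iff)
          (meson S_closed cl_in le_cl le_trans meet_closed meet_left meet_right)
      have "x \<sqinter> y \<sqsubseteq> cl (x \<sqinter> y)" using xy by (simp add: le_cl)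
      then have "x \<sqinter> cl y \<sqsubseteq> cl (x \<sqinter> y)" using xy by (simp add: meet_cl_le)
      then have "cl y \<sqinter> x \<sqsubseteq> cl (x \<sqinter> y)" by (simp add: meet_comm)
      then have "cl y \<sqinter> cl x \<sqsubseteq> cl (x \<sqinter> y)" using xy by (simp add: meet_cl_le)
      then show "cl x \<sqinter>\<^bsub>N\<^esub> cl y \<sqsubseteq>\<^bsub>N\<^esub> cl (x \<sqinter> y)"
        using xy by (simp add: N_meet meet_comm)
      show "cl (x \<sqinter> y) \<in> carrier N" "cl x \<sqinter>\<^bsub>N\<^esub> cl y \<in> carrier N"
        using xy by (auto simp: N_meet meet_in)
    qed
    show "cl (\<Squnion>A) = \<Squnion>\<^bsub>N\<^esub>(cl ` A)" if A: "A \<subseteq> carrier L" for A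
    proof (rule N.sup_eqI[symmetric])
      have [simp]: "x \<in> A \<Longrightarrow> x \<in> carrier L" for x using A by auto
      show "cl ` A \<subseteq> carrier N" "cl (\<Squnion>A) \<in> carrier N" using A by auto
      show "x \<sqsubseteq>\<^bsub>N\<^esub> cl (\<Squnion>A)" if "x \<in> cl ` A" for x
        using that A by (auto simp: cl_le_iff)
          (meson A S_closed cl_in le_cl le_trans subsetD sup_closed sup_upper)
      show "cl (\<Squnion>A) \<sqsubseteq>\<^bsub>N\<^esub> w"
        if "w \<in> carrier N" "\<And>x. x \<in> cl ` A \<Longrightarrow> x \<sqsubseteq>\<^bsub>N\<^esub> w" for w
      proof -
        have "x \<sqsubseteq> w" if "x \<in> A" for x
          using \<open>w \<in> carrier N\<close> \<open>\<And>x. x \<in> cl ` A \<Longrightarrow> x \<sqsubseteq>\<^bsub>N\<^esub> w\<close>[of "cl x"] that by (simp add: cl_le_iff)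
        then show ?thesis using that A by (simp add: cl_le_iff sup_le_iff)
      qed
    qed
  qed (auto simp: frame_axioms N_frame)
  moreover have "cl ` carrier L = carrier N"
    using cl_id by (auto simp: image_iff) (metis S_closed)
  ultimately show ?thesis by (simp add: is_sublocale_def)
qed

end


subsection \<open>The type of the test sublocales in weak closedness\<close>

lemma sublocale_representative:
  assumes "is_sublocale X C k"
  obtains B :: "'x gorder" and j h where "is_sublocale (X :: 'x gorder) B j"
    "frame_iso B C h" "\<And>x. x \<in> carrier X \<Longrightarrow> h (j x) = k x"
proof -
  interpret k: frame_map X C k using assms by (simp add: is_sublocale_def)
  have surj: "k ` carrier X = carrier C" using assms by (simp add: is_sublocale_def)
  let ?r = "right_adjoint X C k"
  have r [simp]: "?r y \<in> carrier X" for y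
    unfolding right_adjoint_def by (rule k.dom.sup_closed) auto
  have kr: "k (?r y) = y" if y: "y \<in> carrier C" for y
  proof (rule k.cod.le_antisym)
    show "k (?r y) \<sqsubseteq>\<^bsub>C\<^esub> y" using y by (simp add: k.right_adjoint)
    obtain x where x: "x \<in> carrier X" "y = k x" using surj y by auto
    then have "x \<sqsubseteq>\<^bsub>X\<^esub> ?r y" using k.right_adjoint[of x y] y by simp
    then show "y \<sqsubseteq>\<^bsub>C\<^esub> k (?r y)" using x by (simp add: k.mono)
  qed (use y in auto)
  have rle: "?r y \<sqsubseteq>\<^bsub>X\<^esub> ?r z \<longleftrightarrow> y \<sqsubseteq>\<^bsub>C\<^esub> z" if "y \<in> carrier C" "z \<in> carrier C" for y z
    using that by (simp add: k.right_adjoint[symmetric] kr)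
  let ?S = "?r ` carrier C"
  interpret S: sublocale_set X ?S
  proof unfold_locales
    show "\<Sqinter>\<^bsub>X\<^esub>A \<in> ?S" if A: "A \<subseteq> ?S" for A
    proof -
      have AX: "A \<subseteq> carrier X" using A by auto
      have kA: "k ` A \<subseteq> carrier C" using AX by auto
      have "\<Sqinter>\<^bsub>X\<^esub>A = ?r (\<Sqinter>\<^bsub>C\<^esub>(k ` A))"
      proof (rule k.dom.inf_eqI)
        show "?r (\<Sqinter>\<^bsub>C\<^esub>(k ` A)) \<sqsubseteq>\<^bsub>X\<^esub> x" if xA: "x \<in> A" for x
        proof -
          obtain y where y: "y \<in> carrier C" "x = ?r y" using subsetD[OF A xA] by blast
          have "\<Sqinter>\<^bsub>C\<^esub>(k ` A) \<sqsubseteq>\<^bsub>C\<^esub> k x" using xA kA by (auto intro!: k.cod.inf_lower)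
          then show ?thesis using y kA by (simp add: rle kr)
        qed
        show "w \<sqsubseteq>\<^bsub>X\<^esub> ?r (\<Sqinter>\<^bsub>C\<^esub>(k ` A))"
          if w: "w \<in> carrier X" "\<And>x. x \<in> A \<Longrightarrow> w \<sqsubseteq>\<^bsub>X\<^esub> x" for w
        proof -
          have "k w \<sqsubseteq>\<^bsub>C\<^esub> \<Sqinter>\<^bsub>C\<^esub>(k ` A)"
            using w AX kA by (intro k.cod.inf_greatest) (auto intro!: k.mono)
          then show ?thesis using w kA by (simp add: k.right_adjoint[symmetric])
        qed
      qed (use AX in auto)
      then show ?thesis using kA by auto
    qed
    show "\<exists>i\<in>?S. \<forall>v\<in>carrier X. v \<sqsubseteq>\<^bsub>X\<^esub> i \<longleftrightarrow> v \<sqinter>\<^bsub>X\<^esub> w \<sqsubseteq>\<^bsub>X\<^esub> s"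
      if s: "s \<in> ?S" and w: "w \<in> carrier X" for s w
    proof -
      obtain y where y: "y \<in> carrier C" "s = ?r y" using s by auto
      let ?T = "{v \<in> carrier X. v \<sqinter>\<^bsub>X\<^esub> w \<sqsubseteq>\<^bsub>X\<^esub> s}"
      have T: "?T \<subseteq> carrier X" by auto
      have sX: "s \<in> carrier X" using y by simp
      have le: "v \<sqinter>\<^bsub>X\<^esub> w \<sqsubseteq>\<^bsub>X\<^esub> s \<longleftrightarrow> k v \<sqinter>\<^bsub>C\<^esub> k w \<sqsubseteq>\<^bsub>C\<^esub> y" if "v \<in> carrier X" for v
        using that w y by (simp add: k.right_adjoint[symmetric] k.map_meet)
      have wT: "w \<sqinter>\<^bsub>X\<^esub> \<Squnion>\<^bsub>X\<^esub>?T \<sqsubseteq>\<^bsub>X\<^esub> s"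
        unfolding k.dom.meet_sup_distrib[OF w T]
        by (rule k.dom.sup_least) (use w sX in \<open>auto simp: meet_comm\<close>)
      let ?t = "\<Squnion>\<^bsub>X\<^esub>?T"
      have tX: "?t \<in> carrier X" using T by simp
      have t: "v \<sqsubseteq>\<^bsub>X\<^esub> ?t \<longleftrightarrow> v \<sqinter>\<^bsub>X\<^esub> w \<sqsubseteq>\<^bsub>X\<^esub> s" if v: "v \<in> carrier X" for v
      proof
        assume "v \<sqsubseteq>\<^bsub>X\<^esub> ?t"
        then have "v \<sqinter>\<^bsub>X\<^esub> w \<sqsubseteq>\<^bsub>X\<^esub> w \<sqinter>\<^bsub>X\<^esub> ?t"
          using v w tX
          by (meson k.dom.le_trans k.dom.meet_closed k.dom.meet_le k.dom.meet_left k.dom.meet_right)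
        then show "v \<sqinter>\<^bsub>X\<^esub> w \<sqsubseteq>\<^bsub>X\<^esub> s"
          using wT v w tX sX by (meson k.dom.le_trans k.dom.meet_closed)
      next
        assume "v \<sqinter>\<^bsub>X\<^esub> w \<sqsubseteq>\<^bsub>X\<^esub> s"
        then show "v \<sqsubseteq>\<^bsub>X\<^esub> ?t" using v T by (intro k.dom.sup_upper) auto
      qed
      have "?r (k ?t) = ?t"
      proof (rule k.dom.le_antisym)
        show "?t \<sqsubseteq>\<^bsub>X\<^esub> ?r (k ?t)" using tX by (simp add: k.right_adjoint[symmetric])
        show "?r (k ?t) \<sqsubseteq>\<^bsub>X\<^esub> ?t"
          using tX t[OF tX] by (simp add: t le kr)
      qed (use tX in auto)
      then have "?t \<in> ?S" by (rule image_eqI[OF sym]) (use tX in simp)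
      then show ?thesis by (rule bexI[rotated]) (use t in simp)
    qed
  qed auto
  interpret N: frame "S.N" by (rule S.N_frame)
  have bij: "bij_betw ?r (carrier C) (carrier S.N)"
    by (auto simp: bij_betw_def intro!: inj_onI) (metis kr)
  have bij': "bij_betw k (carrier S.N) (carrier C)"
    by (rule bij_betw_byWitness[where f' = ?r]) (auto simp: kr)
  have "frame_iso S.N C k"
    unfolding frame_iso_def
  proof (intro conjI exI)
    show "frame_map S.N C k"
      by (rule order_iso_frame_map) (use bij' in \<open>auto simp: k.cod.frame_axioms S.N_frame kr rle\<close>)
    show "frame_map C S.N ?r"
      by (rule order_iso_frame_map) (use bij in \<open>auto simp: k.cod.frame_axioms S.N_frame rle\<close>)
  qed (auto simp: kr)
  moreover have "k (S.cl x) = k x" if x: "x \<in> carrier X" for x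
  proof (rule k.cod.le_antisym)
    have "S.cl x \<sqsubseteq>\<^bsub>X\<^esub> ?r (k x)"
      using x by (subst S.cl_le_iff) (simp_all add: k.right_adjoint[symmetric])
    then show "k (S.cl x) \<sqsubseteq>\<^bsub>C\<^esub> k x"
      by (subst k.right_adjoint) (use x in simp_all)
    show "k x \<sqsubseteq>\<^bsub>C\<^esub> k (S.cl x)"
      using x by (intro k.mono) (auto simp: S.le_cl)
  qed (use x in auto)
  ultimately show thesis
    using that[OF S.cl_sublocale] by blast
qed

lemma bang_map:
  assumes "frame_map L M f" shows "f (bang L p) = bang M p"
proof -
  interpret f: frame_map L M f by fact
  have "frame_map truth_values M (f \<circ> bang L)"
    using frame_map_comp[OF truth_values_initial(1) assms] f.dom.frame_axioms by blast
  then show ?thesis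
    using truth_values_initial(2) f.cod.frame_axioms by (metis comp_apply)
qed

lemma strongly_dense_alt:
  assumes "frame_map Y X f"
  shows "strongly_dense X Y f \<longleftrightarrow>
    (\<forall>p. \<forall>y\<in>carrier Y. f y \<sqsubseteq>\<^bsub>X\<^esub> bang X p \<longrightarrow> y \<sqsubseteq>\<^bsub>Y\<^esub> bang Y p)"
proof -
  interpret f: frame_map Y X f by fact
  have b: "bang X p \<in> carrier X" "bang Y p \<in> carrier Y" for p
    unfolding bang_def by (auto intro!: f.dom.sup_closed f.cod.sup_closed)
  have "right_adjoint Y X f (bang X p) \<sqsubseteq>\<^bsub>Y\<^esub> bang Y p \<longleftrightarrow>
    (\<forall>y\<in>carrier Y. f y \<sqsubseteq>\<^bsub>X\<^esub> bang X p \<longrightarrow> y \<sqsubseteq>\<^bsub>Y\<^esub> bang Y p)" for p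
    unfolding right_adjoint_def using b by (subst f.dom.sup_le_iff) auto
  then show ?thesis
    using assms by (simp add: strongly_dense_def truth_values_def)
qed

lemma frame_iso_comp:
  assumes "frame_iso L M f" "frame_iso M N g" shows "frame_iso L N (g \<circ> f)"
proof -
  obtain f' g' where f: "frame_map L M f" "frame_map M L f'" "\<forall>x\<in>carrier L. f' (f x) = x"
      "\<forall>y\<in>carrier M. f (f' y) = y"
    and g: "frame_map M N g" "frame_map N M g'" "\<forall>x\<in>carrier M. g' (g x) = x"
      "\<forall>y\<in>carrier N. g (g' y) = y"
    using assms unfolding frame_iso_def by blast
  show ?thesis
    unfolding frame_iso_def
    using frame_map_comp[OF f(1) g(1)] frame_map_comp[OF g(2) f(2)] f(3,4) g(3,4)
      frame_map.closed[OF f(1)] frame_map.closed[OF g(2)]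
    by (metis comp_apply)
qed

theorem weakly_closed_any_type:
  fixes X :: "'x gorder" and A :: "'a gorder" and C :: "'c gorder"
  assumes wc: "weakly_closed X A i" and inc: "sublocale_inclusion X A i C k g"
    and sd: "strongly_dense A C g"
  shows "frame_iso C A g"
proof -
  have C: "is_sublocale X C k" and g: "frame_map C A g"
    and gk: "\<forall>x\<in>carrier X. g (k x) = i x" and A: "is_sublocale X A i"
    using inc by (auto simp: sublocale_inclusion_def)
  obtain B :: "'x gorder" and j h where B: "is_sublocale X B j" "frame_iso B C h"
    and hj: "\<And>x. x \<in> carrier X \<Longrightarrow> h (j x) = k x"
    using sublocale_representative[OF C] by metis
  obtain h' where h: "frame_map B C h" "frame_map C B h'"
    "\<forall>x\<in>carrier B. h' (h x) = x" "\<forall>y\<in>carrier C. h (h' y) = y"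
    using B(2) unfolding frame_iso_def by blast
  then have h'iso: "frame_iso C B h'" by (auto simp: frame_iso_def)
  interpret h: frame_map B C h by fact
  have gh: "frame_map B A (g \<circ> h)" using frame_map_comp[OF h(1) g] .
  have "sublocale_inclusion X A i B j (g \<circ> h)"
    using A B(1) gh gk hj by (simp add: sublocale_inclusion_def)
  moreover have "strongly_dense A B (g \<circ> h)"
    unfolding strongly_dense_alt[OF gh]
  proof (intro allI ballI impI)
    fix p y
    assume y: "y \<in> carrier B" and "(g \<circ> h) y \<sqsubseteq>\<^bsub>A\<^esub> bang A p"
    then have "h y \<sqsubseteq>\<^bsub>C\<^esub> bang C p"
      using sd strongly_dense_alt[OF g] by simp
    then have "h' (h y) \<sqsubseteq>\<^bsub>B\<^esub> h' (bang C p)"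
      using y bang_map[OF h(1), of p]
      by (intro frame_map.mono[OF h(2)]) (auto simp: bang_def intro!: h.cod.sup_closed)
    then show "y \<sqsubseteq>\<^bsub>B\<^esub> bang B p"
      using y h(3) bang_map[OF h(2)] by simp
  qed
  ultimately have "frame_iso B A (g \<circ> h)"
    using wc unfolding weakly_closed_def by blast
  then have "frame_iso C A ((g \<circ> h) \<circ> h')"
    using frame_iso_comp[OF h'iso] by blast
  then obtain u where u: "frame_map A C u" "\<forall>x\<in>carrier C. u (((g \<circ> h) \<circ> h') x) = x"
    "\<forall>y\<in>carrier A. ((g \<circ> h) \<circ> h') (u y) = y"
    unfolding frame_iso_def by blast
  show ?thesis
    unfolding frame_iso_def
  proof (intro conjI exI)
    show "frame_map A C u" by fact
    show "\<forall>x\<in>carrier C. u (g x) = x" using u h(4) by simp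
    show "\<forall>y\<in>carrier A. g (u y) = y"
      using u h(4) frame_map.closed[OF u(1)] by simp
  qed fact
qed

subsection \<open>The coproduct\<close>

lemma biidealD:
  assumes "biideal L M I"
  shows "(x, y) \<in> I \<Longrightarrow> x \<in> carrier L" "(x, y) \<in> I \<Longrightarrow> y \<in> carrier M"
    and "\<lbrakk>(x, y) \<in> I; x' \<in> carrier L; y' \<in> carrier M; x' \<sqsubseteq>\<^bsub>L\<^esub> x; y' \<sqsubseteq>\<^bsub>M\<^esub> y\<rbrakk> \<Longrightarrow> (x', y') \<in> I"
    and "\<lbrakk>A \<subseteq> carrier L; y \<in> carrier M; \<And>x. x \<in> A \<Longrightarrow> (x, y) \<in> I\<rbrakk> \<Longrightarrow> (\<Squnion>\<^bsub>L\<^esub>A, y) \<in> I"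
    and "\<lbrakk>x \<in> carrier L; B \<subseteq> carrier M; \<And>y. y \<in> B \<Longrightarrow> (x, y) \<in> I\<rbrakk> \<Longrightarrow> (x, \<Squnion>\<^bsub>M\<^esub>B) \<in> I"
  using assms by (auto simp: biideal_def)

lemma biidealI:
  assumes "I \<subseteq> carrier L \<times> carrier M"
    and "\<And>x y x' y'. \<lbrakk>(x, y) \<in> I; x' \<in> carrier L; y' \<in> carrier M; x' \<sqsubseteq>\<^bsub>L\<^esub> x; y' \<sqsubseteq>\<^bsub>M\<^esub> y\<rbrakk> \<Longrightarrow> (x', y') \<in> I"
    and "\<And>A y. \<lbrakk>A \<subseteq> carrier L; y \<in> carrier M; \<And>x. x \<in> A \<Longrightarrow> (x, y) \<in> I\<rbrakk> \<Longrightarrow> (\<Squnion>\<^bsub>L\<^esub>A, y) \<in> I"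
    and "\<And>x B. \<lbrakk>x \<in> carrier L; B \<subseteq> carrier M; \<And>y. y \<in> B \<Longrightarrow> (x, y) \<in> I\<rbrakk> \<Longrightarrow> (x, \<Squnion>\<^bsub>M\<^esub>B) \<in> I"
  shows "biideal L M I"
  unfolding biideal_def using assms(1) by (auto intro: assms(2-4))

locale frame_pair = L: frame L + M: frame M for L :: "'a gorder" and M :: "'b gorder"
begin

abbreviation "T \<equiv> coprod L M"

lemma carrier_T [simp]: "carrier T = {I. biideal L M I}"
  and le_T [simp]: "le T = (\<subseteq>)"
  and eq_T [simp]: "eq T = (=)"
  by (simp_all add: coprod_def)

lemma biideal_Inter:
  assumes "\<And>I. I \<in> F \<Longrightarrow> biideal L M I"
  shows "biideal L M (carrier L \<times> carrier M \<inter> \<Inter>F)"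
proof (rule biidealI)
  fix x y x' y'
  assume "(x, y) \<in> carrier L \<times> carrier M \<inter> \<Inter>F" "x' \<in> carrier L" "y' \<in> carrier M"
    "x' \<sqsubseteq>\<^bsub>L\<^esub> x" "y' \<sqsubseteq>\<^bsub>M\<^esub> y"
  then show "(x', y') \<in> carrier L \<times> carrier M \<inter> \<Inter>F"
    by (auto intro: biidealD(3)[OF assms])
next
  fix A y
  assume "A \<subseteq> carrier L" "y \<in> carrier M" "\<And>x. x \<in> A \<Longrightarrow> (x, y) \<in> carrier L \<times> carrier M \<inter> \<Inter>F"
  then show "(\<Squnion>\<^bsub>L\<^esub>A, y) \<in> carrier L \<times> carrier M \<inter> \<Inter>F"
    using assms by (auto intro!: biidealD(4))
next
  fix x B
  assume "x \<in> carrier L" "B \<subseteq> carrier M" "\<And>y. y \<in> B \<Longrightarrow> (x, y) \<in> carrier L \<times> carrier M \<inter> \<Inter>F"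
  then show "(x, \<Squnion>\<^bsub>M\<^esub>B) \<in> carrier L \<times> carrier M \<inter> \<Inter>F"
    using assms by (auto intro!: biidealD(5))
qed auto

lemma T_partial_order: "partial_order T"
  by unfold_locales auto

lemma T_glb:
  assumes "F \<subseteq> carrier T"
  shows "greatest T (carrier L \<times> carrier M \<inter> \<Inter>F) (Lower T F)"
proof -
  let ?I = "carrier L \<times> carrier M \<inter> \<Inter>F"
  have "biideal L M ?I" by (rule biideal_Inter) (use assms in auto)
  moreover have "J \<subseteq> carrier L \<times> carrier M" if "biideal L M J" for J
    using that by (simp add: biideal_def)
  moreover have "F \<inter> {I. biideal L M I} = F" using assms by auto
  ultimately show ?thesis
    by (simp add: greatest_def Lower_def) (simp add: le_Inf_iff Inf_lower le_infI2)
qed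

lemma T_complete_lattice: "complete_lattice T"
proof -
  interpret partial_order T by (rule T_partial_order)
  show ?thesis
  proof (rule complete_lattice_criterion1)
    show "\<exists>g. greatest T g (carrier T)"
      using T_glb[of "{}"] by auto
    show "\<exists>i. greatest T i (Lower T F)" if "F \<subseteq> carrier T" for F
      using T_glb[OF that] by blast
  qed
qed

lemma T_inf:
  assumes "F \<subseteq> carrier T"
  shows "\<Sqinter>\<^bsub>T\<^esub>F = carrier L \<times> carrier M \<inter> \<Inter>F"
proof -
  interpret complete_lattice T by (rule T_complete_lattice)
  show ?thesis
    using weak_greatest_unique[OF inf_glb[OF assms] T_glb[OF assms]] by simp
qed

lemma T_meet: "biideal L M I \<Longrightarrow> biideal L M J \<Longrightarrow> I \<sqinter>\<^bsub>T\<^esub> J = I \<inter> J"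
proof -
  assume "biideal L M I" "biideal L M J"
  moreover from this have "I \<subseteq> carrier L \<times> carrier M" by (simp add: biideal_def)
  ultimately show ?thesis by (simp add: meet_def T_inf Int_absorb1 le_infI1)
qed

lemma meet_mem:
  assumes "biideal L M I" "(x, y) \<in> I" "a \<in> carrier L" "b \<in> carrier M"
  shows "(x \<sqinter>\<^bsub>L\<^esub> a, y \<sqinter>\<^bsub>M\<^esub> b) \<in> I" "(a \<sqinter>\<^bsub>L\<^esub> x, b \<sqinter>\<^bsub>M\<^esub> y) \<in> I"
proof -
  note c = biidealD(1,2)[OF assms(1,2)] assms(3,4)
  show "(x \<sqinter>\<^bsub>L\<^esub> a, y \<sqinter>\<^bsub>M\<^esub> b) \<in> I"
    by (rule biidealD(3)[OF assms(1,2)]) (simp_all add: c L.meet_left M.meet_left)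
  show "(a \<sqinter>\<^bsub>L\<^esub> x, b \<sqinter>\<^bsub>M\<^esub> y) \<in> I"
    by (rule biidealD(3)[OF assms(1,2)]) (simp_all add: c L.meet_right M.meet_right)
qed

lemma T_frame: "frame T"
proof -
  interpret T: complete_lattice T by (rule T_complete_lattice)
  show ?thesis
  proof (rule T.frameI)
    fix I F J
    assume I: "I \<in> carrier T" and F: "F \<subseteq> carrier T" and J: "J \<in> carrier T"
      and le: "\<And>K. K \<in> F \<Longrightarrow> I \<sqinter>\<^bsub>T\<^esub> K \<sqsubseteq>\<^bsub>T\<^esub> J"
    have I': "biideal L M I" and J': "biideal L M J" using I J by auto
    note Ic = biidealD(1,2)[OF I']
    define K where "K = {(a, b) \<in> carrier L \<times> carrier M.
      \<forall>(c, e)\<in>I. (c \<sqinter>\<^bsub>L\<^esub> a, e \<sqinter>\<^bsub>M\<^esub> b) \<in> J}"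
    have KD: "(c \<sqinter>\<^bsub>L\<^esub> a, e \<sqinter>\<^bsub>M\<^esub> b) \<in> J" if "(a, b) \<in> K" "(c, e) \<in> I" for a b c e
      using that by (auto simp: K_def)
    have K: "biideal L M K"
    proof (rule biidealI)
      show "K \<subseteq> carrier L \<times> carrier M" by (auto simp: K_def)
    next
      fix x y x' y'
      assume h: "(x, y) \<in> K" "x' \<in> carrier L" "y' \<in> carrier M" "x' \<sqsubseteq>\<^bsub>L\<^esub> x" "y' \<sqsubseteq>\<^bsub>M\<^esub> y"
      have "(c \<sqinter>\<^bsub>L\<^esub> x', e \<sqinter>\<^bsub>M\<^esub> y') \<in> J" if ce: "(c, e) \<in> I" for c e
      proof (rule biidealD(3)[OF J'])
        show "(c \<sqinter>\<^bsub>L\<^esub> x, e \<sqinter>\<^bsub>M\<^esub> y) \<in> J" using h ce by (auto simp: K_def)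
        have [simp]: "c \<in> carrier L" "e \<in> carrier M" "x \<in> carrier L" "y \<in> carrier M"
          using Ic[OF ce] h by (auto simp: K_def)
        show "c \<sqinter>\<^bsub>L\<^esub> x' \<sqsubseteq>\<^bsub>L\<^esub> c \<sqinter>\<^bsub>L\<^esub> x"
          using h(2,4) by (simp add: L.meet_le_iff L.meet_left)
            (metis L.le_trans L.meet_closed L.meet_right \<open>c \<in> carrier L\<close> \<open>x \<in> carrier L\<close>)
        show "e \<sqinter>\<^bsub>M\<^esub> y' \<sqsubseteq>\<^bsub>M\<^esub> e \<sqinter>\<^bsub>M\<^esub> y"
          using h(3,5) by (simp add: M.meet_le_iff M.meet_left)
            (metis M.le_trans M.meet_closed M.meet_right \<open>e \<in> carrier M\<close> \<open>y \<in> carrier M\<close>)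
        show "c \<sqinter>\<^bsub>L\<^esub> x' \<in> carrier L" "e \<sqinter>\<^bsub>M\<^esub> y' \<in> carrier M" using h by auto
      qed
      then show "(x', y') \<in> K" using h by (auto simp: K_def)
    next
      fix A y
      assume h: "A \<subseteq> carrier L" "y \<in> carrier M" "\<And>x. x \<in> A \<Longrightarrow> (x, y) \<in> K"
      have "(c \<sqinter>\<^bsub>L\<^esub> \<Squnion>\<^bsub>L\<^esub>A, e \<sqinter>\<^bsub>M\<^esub> y) \<in> J" if ce: "(c, e) \<in> I" for c e
        unfolding L.meet_sup_distrib[OF Ic(1)[OF ce] h(1)]
        by (rule biidealD(4)[OF J']) (use Ic[OF ce] h(1,2) KD[OF h(3) ce] in auto)
      then show "(\<Squnion>\<^bsub>L\<^esub>A, y) \<in> K" using h by (auto simp: K_def)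
    next
      fix x B
      assume h: "x \<in> carrier L" "B \<subseteq> carrier M" "\<And>y. y \<in> B \<Longrightarrow> (x, y) \<in> K"
      have "(c \<sqinter>\<^bsub>L\<^esub> x, e \<sqinter>\<^bsub>M\<^esub> \<Squnion>\<^bsub>M\<^esub>B) \<in> J" if ce: "(c, e) \<in> I" for c e
        unfolding M.meet_sup_distrib[OF Ic(2)[OF ce] h(2)]
        by (rule biidealD(5)[OF J']) (use Ic[OF ce] h(1,2) KD[OF h(3) ce] in auto)
      then show "(x, \<Squnion>\<^bsub>M\<^esub>B) \<in> K" using h by (auto simp: K_def)
    qed
    have "G \<subseteq> K" if G: "G \<in> F" for G
    proof -
      have G': "biideal L M G" using F G by auto
      have IG: "I \<inter> G \<subseteq> J" using le[OF G] T_meet[OF I' G'] by simp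
      show ?thesis
      proof
        fix p assume p: "p \<in> G"
        obtain a b where ab: "p = (a, b)" by fastforce
        have abc: "a \<in> carrier L" "b \<in> carrier M" using biidealD(1,2)[OF G'] p ab by auto
        have "(c \<sqinter>\<^bsub>L\<^esub> a, e \<sqinter>\<^bsub>M\<^esub> b) \<in> J" if ce: "(c, e) \<in> I" for c e
          using meet_mem(1)[OF I' ce abc] meet_mem(2)[OF G' p[unfolded ab] Ic[OF ce]] IG by auto
        then show "p \<in> K" using ab abc by (auto simp: K_def)
      qed
    qed
    then have FK: "\<Squnion>\<^bsub>T\<^esub>F \<subseteq> K"
      using T.sup_least[OF F, of K] K by auto
    have S: "biideal L M (\<Squnion>\<^bsub>T\<^esub>F)" using T.sup_closed[OF F] by simp
    have "I \<inter> \<Squnion>\<^bsub>T\<^esub>F \<subseteq> J"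
    proof
      fix p assume p: "p \<in> I \<inter> \<Squnion>\<^bsub>T\<^esub>F"
      obtain a b where ab: "p = (a, b)" by fastforce
      have abc: "a \<in> carrier L" "b \<in> carrier M" using Ic p ab by auto
      have "(a \<sqinter>\<^bsub>L\<^esub> a, b \<sqinter>\<^bsub>M\<^esub> b) \<in> J" using FK p ab by (auto simp: K_def)
      moreover have "a \<sqinter>\<^bsub>L\<^esub> a = a" "b \<sqinter>\<^bsub>M\<^esub> b = b"
        using abc by (auto intro!: L.meet_eqI M.meet_eqI)
      ultimately show "p \<in> J" using ab by simp
    qed
    then show "I \<sqinter>\<^bsub>T\<^esub> \<Squnion>\<^bsub>T\<^esub>F \<sqsubseteq>\<^bsub>T\<^esub> J" using T_meet[OF I' S] by simp
  qed
qed

lemma inj1_biideal: assumes "x \<in> carrier L" shows "biideal L M (inj1 L M x)"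
proof (rule biidealI)
  fix a b a' b'
  assume "(a, b) \<in> inj1 L M x" "a' \<in> carrier L" "b' \<in> carrier M" "a' \<sqsubseteq>\<^bsub>L\<^esub> a" "b' \<sqsubseteq>\<^bsub>M\<^esub> b"
  then show "(a', b') \<in> inj1 L M x"
    using assms unfolding inj1_def
    by (auto intro: L.le_trans)
next
  fix A y
  assume h: "A \<subseteq> carrier L" "y \<in> carrier M" "\<And>a. a \<in> A \<Longrightarrow> (a, y) \<in> inj1 L M x"
  then show "(\<Squnion>\<^bsub>L\<^esub>A, y) \<in> inj1 L M x"
    using assms by (auto simp: inj1_def L.sup_le_iff)
next
  fix a B
  assume h: "a \<in> carrier L" "B \<subseteq> carrier M" "\<And>b. b \<in> B \<Longrightarrow> (a, b) \<in> inj1 L M x"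
  show "(a, \<Squnion>\<^bsub>M\<^esub>B) \<in> inj1 L M x"
  proof (cases "a \<sqsubseteq>\<^bsub>L\<^esub> x")
    case True then show ?thesis using h by (auto simp: inj1_def)
  next
    case False
    then have "\<And>b. b \<in> B \<Longrightarrow> b = \<bottom>\<^bsub>M\<^esub>" using h by (auto simp: inj1_def)
    then have "\<Squnion>\<^bsub>M\<^esub>B = \<bottom>\<^bsub>M\<^esub>" using h by (intro M.sup_eqI) auto
    then show ?thesis using h by (auto simp: inj1_def)
  qed
qed (auto simp: inj1_def)

lemma inj2_biideal: assumes "y \<in> carrier M" shows "biideal L M (inj2 L M y)"
proof (rule biidealI)
  fix a b a' b'
  assume "(a, b) \<in> inj2 L M y" "a' \<in> carrier L" "b' \<in> carrier M" "a' \<sqsubseteq>\<^bsub>L\<^esub> a" "b' \<sqsubseteq>\<^bsub>M\<^esub> b"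
  then show "(a', b') \<in> inj2 L M y"
    using assms unfolding inj2_def
    by (auto intro: M.le_trans)
next
  fix a B
  assume h: "a \<in> carrier L" "B \<subseteq> carrier M" "\<And>b. b \<in> B \<Longrightarrow> (a, b) \<in> inj2 L M y"
  then show "(a, \<Squnion>\<^bsub>M\<^esub>B) \<in> inj2 L M y"
    using assms by (auto simp: inj2_def M.sup_le_iff)
next
  fix A b
  assume h: "A \<subseteq> carrier L" "b \<in> carrier M" "\<And>a. a \<in> A \<Longrightarrow> (a, b) \<in> inj2 L M y"
  show "(\<Squnion>\<^bsub>L\<^esub>A, b) \<in> inj2 L M y"
  proof (cases "b \<sqsubseteq>\<^bsub>M\<^esub> y")
    case True then show ?thesis using h by (auto simp: inj2_def)
  next
    case False
    then have "\<And>a. a \<in> A \<Longrightarrow> a = \<bottom>\<^bsub>L\<^esub>" using h by (auto simp: inj2_def)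
    then have "\<Squnion>\<^bsub>L\<^esub>A = \<bottom>\<^bsub>L\<^esub>" using h by (intro L.sup_eqI) auto
    then show ?thesis using h by (auto simp: inj2_def)
  qed
qed (auto simp: inj2_def)

lemma bottom_mem:
  assumes "biideal L M I"
  shows "b \<in> carrier M \<Longrightarrow> (\<bottom>\<^bsub>L\<^esub>, b) \<in> I" "a \<in> carrier L \<Longrightarrow> (a, \<bottom>\<^bsub>M\<^esub>) \<in> I"
proof -
  have "\<Squnion>\<^bsub>L\<^esub>{} = \<bottom>\<^bsub>L\<^esub>" "\<Squnion>\<^bsub>M\<^esub>{} = \<bottom>\<^bsub>M\<^esub>"
    by (auto intro!: L.sup_eqI M.sup_eqI)
  then show "b \<in> carrier M \<Longrightarrow> (\<bottom>\<^bsub>L\<^esub>, b) \<in> I" "a \<in> carrier L \<Longrightarrow> (a, \<bottom>\<^bsub>M\<^esub>) \<in> I"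
    using biidealD(4)[OF assms, of "{}" b] biidealD(5)[OF assms, of a "{}"] by auto
qed

lemma rect_eq:
  assumes "x \<in> carrier L" "y \<in> carrier M"
  shows "rect L M x y = inj1 L M x \<inter> inj2 L M y"
  unfolding rect_def using assms by (simp add: T_meet inj1_biideal inj2_biideal)

lemma rect_biideal:
  assumes "x \<in> carrier L" "y \<in> carrier M"
  shows "biideal L M (rect L M x y)"
proof -
  interpret T: frame T by (rule T_frame)
  show ?thesis
    using T.meet_closed[of "inj1 L M x" "inj2 L M y"] assms
    by (simp add: rect_def inj1_biideal inj2_biideal)
qed

lemma rect_le_iff:
  assumes "x \<in> carrier L" "y \<in> carrier M" "biideal L M I"
  shows "rect L M x y \<subseteq> I \<longleftrightarrow> (x, y) \<in> I"
proof
  assume "rect L M x y \<subseteq> I"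
  moreover have "(x, y) \<in> rect L M x y"
    using assms by (auto simp: rect_eq inj1_def inj2_def)
  ultimately show "(x, y) \<in> I" by blast
next
  assume "(x, y) \<in> I"
  then show "rect L M x y \<subseteq> I"
    using assms by (auto simp: rect_eq inj1_def inj2_def bottom_mem intro: biidealD(3)[OF assms(3)])
qed

lemma sup_rects:
  assumes "biideal L M I"
  shows "\<Squnion>\<^bsub>T\<^esub>{rect L M x y | x y. (x, y) \<in> I} = I"
proof -
  interpret T: frame T by (rule T_frame)
  note c = biidealD(1,2)[OF assms]
  let ?F = "{rect L M x y | x y. (x, y) \<in> I}"
  have rI: "rect L M x y \<subseteq> I" if "(x, y) \<in> I" for x y
    using that by (simp add: rect_le_iff assms c)
  show ?thesis
  proof (rule T.sup_eqI)
    show "?F \<subseteq> carrier T" using c by (auto simp: rect_biideal)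
    show "I \<in> carrier T" using assms by simp
    show "\<And>J. J \<in> ?F \<Longrightarrow> J \<sqsubseteq>\<^bsub>T\<^esub> I" using rI by auto
    fix w assume w: "w \<in> carrier T" "\<And>J. J \<in> ?F \<Longrightarrow> J \<sqsubseteq>\<^bsub>T\<^esub> w"
    have "(x, y) \<in> w" if "(x, y) \<in> I" for x y
    proof -
      have "rect L M x y \<subseteq> w" using w(2)[of "rect L M x y"] that by auto
      then show ?thesis using w(1) c[OF that] by (simp add: rect_le_iff)
    qed
    then show "I \<sqsubseteq>\<^bsub>T\<^esub> w" by auto
  qed
qed

lemma inj1_frame_map: "frame_map L T (inj1 L M)"
proof -
  interpret T: frame T by (rule T_frame)
  have le: "inj1 L M x \<subseteq> I \<longleftrightarrow> (x, \<top>\<^bsub>M\<^esub>) \<in> I" if "x \<in> carrier L" "biideal L M I" for x I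
  proof -
    have "inj2 L M \<top>\<^bsub>M\<^esub> = carrier L \<times> carrier M" by (auto simp: inj2_def)
    then have "rect L M x \<top>\<^bsub>M\<^esub> = inj1 L M x" using that by (auto simp: rect_eq inj1_def)
    then show ?thesis using rect_le_iff[of x "\<top>\<^bsub>M\<^esub>" I] that by simp
  qed
  show ?thesis
  proof (rule frame_mapI)
    show "inj1 L M \<top>\<^bsub>L\<^esub> = \<top>\<^bsub>T\<^esub>"
      by (rule T.top_eq) (auto simp: inj1_biideal, auto simp: inj1_def dest: biidealD)
    show "inj1 L M (x \<sqinter>\<^bsub>L\<^esub> y) = inj1 L M x \<sqinter>\<^bsub>T\<^esub> inj1 L M y"
      if "x \<in> carrier L" "y \<in> carrier L" for x y
      using that by (subst T_meet) (auto simp: inj1_biideal, auto simp: inj1_def L.meet_le_iff)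
    show "inj1 L M (\<Squnion>\<^bsub>L\<^esub>A) = \<Squnion>\<^bsub>T\<^esub>(inj1 L M ` A)" if A: "A \<subseteq> carrier L" for A
    proof (rule T.sup_eqI[symmetric])
      have [simp]: "x \<in> A \<Longrightarrow> x \<in> carrier L" for x using A by auto
      show "inj1 L M ` A \<subseteq> carrier T" "inj1 L M (\<Squnion>\<^bsub>L\<^esub>A) \<in> carrier T"
        using A by (auto simp: inj1_biideal)
      show "x \<sqsubseteq>\<^bsub>T\<^esub> inj1 L M (\<Squnion>\<^bsub>L\<^esub>A)" if x: "x \<in> inj1 L M ` A" for x
      proof -
        obtain a where a: "a \<in> A" "x = inj1 L M a" using x by blast
        have "a \<sqsubseteq>\<^bsub>L\<^esub> \<Squnion>\<^bsub>L\<^esub>A" using A a by (intro L.sup_upper)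
        then show ?thesis using A a by (simp add: le inj1_biideal) (simp add: inj1_def)
      qed
      show "inj1 L M (\<Squnion>\<^bsub>L\<^esub>A) \<sqsubseteq>\<^bsub>T\<^esub> w"
        if "w \<in> carrier T" "\<And>x. x \<in> inj1 L M ` A \<Longrightarrow> x \<sqsubseteq>\<^bsub>T\<^esub> w" for w
        using that A by (simp add: le) (rule biidealD(4), auto simp: le[symmetric])
    qed
  qed (auto simp: L.frame_axioms T_frame inj1_biideal)
qed

lemma inj2_frame_map: "frame_map M T (inj2 L M)"
proof -
  interpret T: frame T by (rule T_frame)
  have le: "inj2 L M x \<subseteq> I \<longleftrightarrow> (\<top>\<^bsub>L\<^esub>, x) \<in> I" if "x \<in> carrier M" "biideal L M I" for x I
  proof -
    have "inj1 L M \<top>\<^bsub>L\<^esub> = carrier L \<times> carrier M" by (auto simp: inj1_def)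
    then have "rect L M \<top>\<^bsub>L\<^esub> x = inj2 L M x" using that by (auto simp: rect_eq inj2_def)
    then show ?thesis using rect_le_iff[of "\<top>\<^bsub>L\<^esub>" x I] that by simp
  qed
  show ?thesis
  proof (rule frame_mapI)
    show "inj2 L M \<top>\<^bsub>M\<^esub> = \<top>\<^bsub>T\<^esub>"
      by (rule T.top_eq) (auto simp: inj2_biideal, auto simp: inj2_def dest: biidealD)
    show "inj2 L M (x \<sqinter>\<^bsub>M\<^esub> y) = inj2 L M x \<sqinter>\<^bsub>T\<^esub> inj2 L M y"
      if "x \<in> carrier M" "y \<in> carrier M" for x y
      using that by (subst T_meet) (auto simp: inj2_biideal, auto simp: inj2_def M.meet_le_iff)
    show "inj2 L M (\<Squnion>\<^bsub>M\<^esub>A) = \<Squnion>\<^bsub>T\<^esub>(inj2 L M ` A)" if A: "A \<subseteq> carrier M" for A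
    proof (rule T.sup_eqI[symmetric])
      have [simp]: "x \<in> A \<Longrightarrow> x \<in> carrier M" for x using A by auto
      show "inj2 L M ` A \<subseteq> carrier T" "inj2 L M (\<Squnion>\<^bsub>M\<^esub>A) \<in> carrier T"
        using A by (auto simp: inj2_biideal)
      show "x \<sqsubseteq>\<^bsub>T\<^esub> inj2 L M (\<Squnion>\<^bsub>M\<^esub>A)" if x: "x \<in> inj2 L M ` A" for x
      proof -
        obtain a where a: "a \<in> A" "x = inj2 L M a" using x by blast
        have "a \<sqsubseteq>\<^bsub>M\<^esub> \<Squnion>\<^bsub>M\<^esub>A" using A a by (intro M.sup_upper)
        then show ?thesis using A a by (simp add: le inj2_biideal) (simp add: inj2_def)
      qed
      show "inj2 L M (\<Squnion>\<^bsub>M\<^esub>A) \<sqsubseteq>\<^bsub>T\<^esub> w"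
        if "w \<in> carrier T" "\<And>x. x \<in> inj2 L M ` A \<Longrightarrow> x \<sqsubseteq>\<^bsub>T\<^esub> w" for w
        using that A by (simp add: le) (rule biidealD(5), auto simp: le[symmetric])
    qed
  qed (auto simp: M.frame_axioms T_frame inj2_biideal)
qed

text \<open>The universal property.\<close>

theorem coprod_unique:
  assumes "frame_map T N h" "frame_map T N h'"
    and "\<And>x. x \<in> carrier L \<Longrightarrow> h (inj1 L M x) = h' (inj1 L M x)"
    and "\<And>y. y \<in> carrier M \<Longrightarrow> h (inj2 L M y) = h' (inj2 L M y)"
    and "I \<in> carrier T"
  shows "h I = h' I"
proof -
  interpret h: frame_map T N h by fact
  interpret h': frame_map T N h' by fact
  have I: "biideal L M I" using assms(5) by simp
  note c = biidealD(1,2)[OF I]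
  have r: "h (rect L M x y) = h' (rect L M x y)" if "x \<in> carrier L" "y \<in> carrier M" for x y
    unfolding rect_def using that assms(3,4)
    by (simp add: h.map_meet h'.map_meet inj1_biideal inj2_biideal)
  let ?F = "{rect L M x y | x y. (x, y) \<in> I}"
  have F: "?F \<subseteq> carrier T" using c by (auto simp: rect_biideal)
  have "h ` ?F = h' ` ?F" using r c by (intro image_cong) auto
  then have "h (\<Squnion>\<^bsub>T\<^esub>?F) = h' (\<Squnion>\<^bsub>T\<^esub>?F)"
    using h.map_sup[OF F] h'.map_sup[OF F] by simp
  then show ?thesis by (simp add: sup_rects I)
qed

theorem coprod_exists:
  assumes "frame_map L N f" "frame_map M N g"
  obtains h where "frame_map T N h"
    and "\<And>x. x \<in> carrier L \<Longrightarrow> h (inj1 L M x) = f x"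
    and "\<And>y. y \<in> carrier M \<Longrightarrow> h (inj2 L M y) = g y"
proof -
  interpret T: frame T by (rule T_frame)
  interpret f: frame_map L N f by fact
  interpret g: frame_map M N g by fact
  define h where "h I = \<Squnion>\<^bsub>N\<^esub>((\<lambda>(x, y). f x \<sqinter>\<^bsub>N\<^esub> g y) ` I)" for I
  have hc: "(\<lambda>(x, y). f x \<sqinter>\<^bsub>N\<^esub> g y) ` I \<subseteq> carrier N" if "biideal L M I" for I
    using biidealD(1,2)[OF that] by auto
  have h_closed: "h I \<in> carrier N" if "biideal L M I" for I
    unfolding h_def using hc[OF that] by simp
  have h_le: "h I \<sqsubseteq>\<^bsub>N\<^esub> n \<longleftrightarrow> (\<forall>(x, y)\<in>I. f x \<sqinter>\<^bsub>N\<^esub> g y \<sqsubseteq>\<^bsub>N\<^esub> n)"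
    if "biideal L M I" "n \<in> carrier N" for I n
    unfolding h_def using hc[OF that(1)] that by (subst f.cod.sup_le_iff) auto
  have h_mem: "f x \<sqinter>\<^bsub>N\<^esub> g y \<sqsubseteq>\<^bsub>N\<^esub> h I" if "biideal L M I" "(x, y) \<in> I" for x y I
    using h_le[OF that(1) h_closed[OF that(1)]] h_closed[OF that(1)] that(2) by auto
  have G: "biideal L M {(x, y) \<in> carrier L \<times> carrier M. f x \<sqinter>\<^bsub>N\<^esub> g y \<sqsubseteq>\<^bsub>N\<^esub> n}"
    (is "biideal L M (?G n)") if n: "n \<in> carrier N" for n
  proof (rule biidealI)
    fix x y x' y'
    assume a: "(x, y) \<in> ?G n" "x' \<in> carrier L" "y' \<in> carrier M" "x' \<sqsubseteq>\<^bsub>L\<^esub> x" "y' \<sqsubseteq>\<^bsub>M\<^esub> y"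
    then have c: "f x' \<in> carrier N" "f x \<in> carrier N" "g y' \<in> carrier N" "g y \<in> carrier N"
      "f x' \<sqinter>\<^bsub>N\<^esub> g y' \<in> carrier N" "f x \<sqinter>\<^bsub>N\<^esub> g y \<in> carrier N" by auto
    have "f x' \<sqsubseteq>\<^bsub>N\<^esub> f x" "g y' \<sqsubseteq>\<^bsub>N\<^esub> g y" using a by (auto intro!: f.mono g.mono)
    then have "f x' \<sqinter>\<^bsub>N\<^esub> g y' \<sqsubseteq>\<^bsub>N\<^esub> f x \<sqinter>\<^bsub>N\<^esub> g y"
      using c by (metis f.cod.le_trans f.cod.meet_le_iff f.cod.meet_left f.cod.meet_right)
    then have "f x' \<sqinter>\<^bsub>N\<^esub> g y' \<sqsubseteq>\<^bsub>N\<^esub> n" using a c n by (auto intro: f.cod.le_trans)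
    then show "(x', y') \<in> ?G n" using a by auto
  next
    fix A y
    assume a: "A \<subseteq> carrier L" "y \<in> carrier M" "\<And>x. x \<in> A \<Longrightarrow> (x, y) \<in> ?G n"
    have fA: "f ` A \<subseteq> carrier N" using a by auto
    have "f (\<Squnion>\<^bsub>L\<^esub>A) \<sqinter>\<^bsub>N\<^esub> g y = g y \<sqinter>\<^bsub>N\<^esub> \<Squnion>\<^bsub>N\<^esub>(f ` A)"
      using a by (simp add: f.map_sup meet_comm)
    also have "\<dots> = \<Squnion>\<^bsub>N\<^esub>((\<lambda>z. g y \<sqinter>\<^bsub>N\<^esub> z) ` f ` A)"
      by (rule f.cod.meet_sup_distrib) (use a fA in auto)
    also have "\<dots> \<sqsubseteq>\<^bsub>N\<^esub> n"
      using a fA n by (intro f.cod.sup_least) (auto simp: meet_comm[of N "g y"])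
    finally show "(\<Squnion>\<^bsub>L\<^esub>A, y) \<in> ?G n" using a by auto
  next
    fix x B
    assume a: "x \<in> carrier L" "B \<subseteq> carrier M" "\<And>y. y \<in> B \<Longrightarrow> (x, y) \<in> ?G n"
    have gB: "g ` B \<subseteq> carrier N" using a by auto
    have "f x \<sqinter>\<^bsub>N\<^esub> g (\<Squnion>\<^bsub>M\<^esub>B) = \<Squnion>\<^bsub>N\<^esub>((\<lambda>z. f x \<sqinter>\<^bsub>N\<^esub> z) ` g ` B)"
      using a gB by (simp add: g.map_sup f.cod.meet_sup_distrib)
    also have "\<dots> \<sqsubseteq>\<^bsub>N\<^esub> n"
      using a gB n by (intro f.cod.sup_least) auto
    finally show "(x, \<Squnion>\<^bsub>M\<^esub>B) \<in> ?G n" using a by auto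
  qed auto
  have adj: "h I \<sqsubseteq>\<^bsub>N\<^esub> n \<longleftrightarrow> I \<subseteq> ?G n" if "biideal L M I" "n \<in> carrier N" for I n
    using h_le[OF that] biidealD(1,2)[OF that(1)] by blast
  have map: "frame_map T N h"
  proof (rule frame_mapI)
    show hT: "h \<in> carrier T \<rightarrow> carrier N" using h_closed by auto
    have tt: "biideal L M \<top>\<^bsub>T\<^esub>" using T.top_closed by simp
    have "(\<top>\<^bsub>L\<^esub>, \<top>\<^bsub>M\<^esub>) \<in> \<top>\<^bsub>T\<^esub>"
      using T.top_higher[of "rect L M \<top>\<^bsub>L\<^esub> \<top>\<^bsub>M\<^esub>"] rect_le_iff[OF _ _ tt] rect_biideal by simp
    then have "\<top>\<^bsub>N\<^esub> \<sqinter>\<^bsub>N\<^esub> \<top>\<^bsub>N\<^esub> \<sqsubseteq>\<^bsub>N\<^esub> h \<top>\<^bsub>T\<^esub>"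
      using h_mem[OF tt] f.map_top g.map_top by metis
    moreover have "\<top>\<^bsub>N\<^esub> \<sqinter>\<^bsub>N\<^esub> \<top>\<^bsub>N\<^esub> = \<top>\<^bsub>N\<^esub>" by (rule f.cod.meet_eqI) auto
    ultimately show "h \<top>\<^bsub>T\<^esub> = \<top>\<^bsub>N\<^esub>"
      using h_closed[OF tt] by (intro f.cod.le_antisym) auto
    show "h (I \<sqinter>\<^bsub>T\<^esub> J) = h I \<sqinter>\<^bsub>N\<^esub> h J" if "I \<in> carrier T" "J \<in> carrier T" for I J
    proof (rule f.cod.le_antisym)
      have I: "biideal L M I" and J: "biideal L M J" and IJ: "biideal L M (I \<inter> J)"
        using that T.meet_closed[OF that] by (auto simp: T_meet)
      have mono: "h (I \<inter> J) \<sqsubseteq>\<^bsub>N\<^esub> h K" if "biideal L M K" "I \<inter> J \<subseteq> K" for K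
        using h_le[OF IJ h_closed[OF that(1)]] h_mem[OF that(1)] that(2) by blast
      show "h (I \<sqinter>\<^bsub>T\<^esub> J) \<sqsubseteq>\<^bsub>N\<^esub> h I \<sqinter>\<^bsub>N\<^esub> h J"
        using mono[OF I] mono[OF J] by (simp add: T_meet I J f.cod.meet_le_iff h_closed IJ)
      have ptw: "(f x \<sqinter>\<^bsub>N\<^esub> g y) \<sqinter>\<^bsub>N\<^esub> (f x' \<sqinter>\<^bsub>N\<^esub> g y') \<sqsubseteq>\<^bsub>N\<^esub> h (I \<inter> J)"
        if xy: "(x, y) \<in> I" and xy': "(x', y') \<in> J" for x y x' y'
      proof -
        note c = biidealD(1,2)[OF I xy] biidealD(1,2)[OF J xy']
        have "(x \<sqinter>\<^bsub>L\<^esub> x', y \<sqinter>\<^bsub>M\<^esub> y') \<in> I \<inter> J"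
          using meet_mem(1)[OF I xy] meet_mem(2)[OF J xy'] c by blast
        from h_mem[OF IJ this]
        have "(f x \<sqinter>\<^bsub>N\<^esub> f x') \<sqinter>\<^bsub>N\<^esub> (g y \<sqinter>\<^bsub>N\<^esub> g y') \<sqsubseteq>\<^bsub>N\<^esub> h (I \<inter> J)"
          using c by (simp add: f.map_meet g.map_meet)
        moreover have "(f x \<sqinter>\<^bsub>N\<^esub> g y) \<sqinter>\<^bsub>N\<^esub> (f x' \<sqinter>\<^bsub>N\<^esub> g y') =
            (f x \<sqinter>\<^bsub>N\<^esub> f x') \<sqinter>\<^bsub>N\<^esub> (g y \<sqinter>\<^bsub>N\<^esub> g y')"
          by (rule f.cod.meet_eqI) (use c in \<open>auto simp: f.cod.meet_le_iff\<close>)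
        ultimately show ?thesis by simp
      qed
      have 1: "h I \<sqinter>\<^bsub>N\<^esub> z \<sqsubseteq>\<^bsub>N\<^esub> n"
        if "biideal L M I" "z \<in> carrier N" "n \<in> carrier N"
          "\<And>x y. (x, y) \<in> I \<Longrightarrow> (f x \<sqinter>\<^bsub>N\<^esub> g y) \<sqinter>\<^bsub>N\<^esub> z \<sqsubseteq>\<^bsub>N\<^esub> n" for I z n
      proof -
        have "h I \<sqinter>\<^bsub>N\<^esub> z = z \<sqinter>\<^bsub>N\<^esub> \<Squnion>\<^bsub>N\<^esub>((\<lambda>(x, y). f x \<sqinter>\<^bsub>N\<^esub> g y) ` I)"
          by (simp add: h_def meet_comm)
        also have "\<dots> = \<Squnion>\<^bsub>N\<^esub>((\<lambda>w. z \<sqinter>\<^bsub>N\<^esub> w) ` (\<lambda>(x, y). f x \<sqinter>\<^bsub>N\<^esub> g y) ` I)"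
          by (rule f.cod.meet_sup_distrib[OF that(2) hc[OF that(1)]])
        also have "\<dots> \<sqsubseteq>\<^bsub>N\<^esub> n"
          using hc[OF that(1)] that
          by (intro f.cod.sup_least) (auto simp: meet_comm[of N z] dest: biidealD(1,2)[OF that(1)])
        finally show ?thesis .
      qed
      have "h I \<sqinter>\<^bsub>N\<^esub> h J \<sqsubseteq>\<^bsub>N\<^esub> h (I \<inter> J)"
      proof (rule 1[OF I h_closed[OF J] h_closed[OF IJ]])
        fix x y assume xy: "(x, y) \<in> I"
        have c: "f x \<sqinter>\<^bsub>N\<^esub> g y \<in> carrier N" using biidealD(1,2)[OF I xy] by simp
        show "(f x \<sqinter>\<^bsub>N\<^esub> g y) \<sqinter>\<^bsub>N\<^esub> h J \<sqsubseteq>\<^bsub>N\<^esub> h (I \<inter> J)"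
          unfolding meet_comm[of N "f x \<sqinter>\<^bsub>N\<^esub> g y"]
          by (rule 1[OF J c h_closed[OF IJ]])
            (use ptw[OF xy] in \<open>simp add: meet_comm[of N _ "f x \<sqinter>\<^bsub>N\<^esub> g y"]\<close>)
      qed
      then show "h I \<sqinter>\<^bsub>N\<^esub> h J \<sqsubseteq>\<^bsub>N\<^esub> h (I \<sqinter>\<^bsub>T\<^esub> J)" by (simp add: T_meet I J)
      show "h (I \<sqinter>\<^bsub>T\<^esub> J) \<in> carrier N" "h I \<sqinter>\<^bsub>N\<^esub> h J \<in> carrier N"
        using I J IJ by (auto simp: T_meet h_closed)
    qed
    show "h (\<Squnion>\<^bsub>T\<^esub>F) = \<Squnion>\<^bsub>N\<^esub>(h ` F)" if F: "F \<subseteq> carrier T" for F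
    proof (rule f.cod.sup_eqI[symmetric])
      have Fb: "I \<in> F \<Longrightarrow> biideal L M I" for I using F by auto
      have S: "biideal L M (\<Squnion>\<^bsub>T\<^esub>F)" using T.sup_closed[OF F] by simp
      show "h ` F \<subseteq> carrier N" "h (\<Squnion>\<^bsub>T\<^esub>F) \<in> carrier N" using Fb S h_closed by auto
      show "z \<sqsubseteq>\<^bsub>N\<^esub> h (\<Squnion>\<^bsub>T\<^esub>F)" if z: "z \<in> h ` F" for z
      proof -
        obtain I where I: "I \<in> F" "z = h I" using z by auto
        have "I \<subseteq> \<Squnion>\<^bsub>T\<^esub>F" using T.sup_upper[OF F I(1)] by simp
        then show ?thesis
          using h_le[OF Fb[OF I(1)] h_closed[OF S]] h_mem[OF S] I by blast
      qed
      show "h (\<Squnion>\<^bsub>T\<^esub>F) \<sqsubseteq>\<^bsub>N\<^esub> w"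
        if w: "w \<in> carrier N" "\<And>x. x \<in> h ` F \<Longrightarrow> x \<sqsubseteq>\<^bsub>N\<^esub> w" for w
      proof -
        have "\<And>I. I \<in> F \<Longrightarrow> I \<subseteq> ?G w" using w adj Fb by blast
        then have "\<Squnion>\<^bsub>T\<^esub>F \<subseteq> ?G w" using T.sup_least[OF F, of "?G w"] G[OF w(1)] by simp
        then show ?thesis using adj[OF S w(1)] by simp
      qed
    qed
  qed (auto simp: T_frame f.cod.frame_axioms)
  have topmeet: "z \<sqinter>\<^bsub>N\<^esub> \<top>\<^bsub>N\<^esub> = z" "\<top>\<^bsub>N\<^esub> \<sqinter>\<^bsub>N\<^esub> z = z" if "z \<in> carrier N" for z
    using that by (auto intro!: f.cod.meet_eqI)
  have botmeet: "z \<sqinter>\<^bsub>N\<^esub> \<bottom>\<^bsub>N\<^esub> = \<bottom>\<^bsub>N\<^esub>" "\<bottom>\<^bsub>N\<^esub> \<sqinter>\<^bsub>N\<^esub> z = \<bottom>\<^bsub>N\<^esub>" if "z \<in> carrier N" for z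
    using that by (auto intro!: f.cod.le_antisym f.cod.meet_left f.cod.meet_right)
  have "h (inj1 L M x) = f x" if x: "x \<in> carrier L" for x
  proof (rule f.cod.le_antisym)
    show "h (inj1 L M x) \<sqsubseteq>\<^bsub>N\<^esub> f x"
      unfolding h_le[OF inj1_biideal[OF x] f.closed[OF x]]
    proof (clarsimp simp: inj1_def)
      fix a b assume a: "a \<in> carrier L" "b \<in> carrier M" "a \<sqsubseteq>\<^bsub>L\<^esub> x \<or> b = \<bottom>\<^bsub>M\<^esub>"
      show "f a \<sqinter>\<^bsub>N\<^esub> g b \<sqsubseteq>\<^bsub>N\<^esub> f x"
      proof (cases "b = \<bottom>\<^bsub>M\<^esub>")
        case True then show ?thesis using a x by (simp add: g.map_bottom botmeet)
      next
        case False
        then have "f a \<sqsubseteq>\<^bsub>N\<^esub> f x" using a x by (auto intro: f.mono)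
        then show ?thesis using a x
          by (meson f.closed g.closed f.cod.le_trans f.cod.meet_closed f.cod.meet_left)
      qed
    qed
    have "(x, \<top>\<^bsub>M\<^esub>) \<in> inj1 L M x" using x by (simp add: inj1_def)
    from h_mem[OF inj1_biideal[OF x] this] show "f x \<sqsubseteq>\<^bsub>N\<^esub> h (inj1 L M x)"
      using x by (simp add: g.map_top topmeet)
  qed (use x in \<open>auto simp: h_closed inj1_biideal\<close>)
  moreover have "h (inj2 L M y) = g y" if y: "y \<in> carrier M" for y
  proof (rule f.cod.le_antisym)
    show "h (inj2 L M y) \<sqsubseteq>\<^bsub>N\<^esub> g y"
      unfolding h_le[OF inj2_biideal[OF y] g.closed[OF y]]
    proof (clarsimp simp: inj2_def)
      fix a b assume a: "a \<in> carrier L" "b \<in> carrier M" "a = \<bottom>\<^bsub>L\<^esub> \<or> b \<sqsubseteq>\<^bsub>M\<^esub> y"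
      show "f a \<sqinter>\<^bsub>N\<^esub> g b \<sqsubseteq>\<^bsub>N\<^esub> g y"
      proof (cases "a = \<bottom>\<^bsub>L\<^esub>")
        case True then show ?thesis using a y by (simp add: f.map_bottom botmeet)
      next
        case False
        then have "g b \<sqsubseteq>\<^bsub>N\<^esub> g y" using a y by (auto intro: g.mono)
        then show ?thesis using a y
          by (meson f.closed g.closed f.cod.le_trans f.cod.meet_closed f.cod.meet_right)
      qed
    qed
    have "(\<top>\<^bsub>L\<^esub>, y) \<in> inj2 L M y" using y by (simp add: inj2_def)
    from h_mem[OF inj2_biideal[OF y] this] show "g y \<sqsubseteq>\<^bsub>N\<^esub> h (inj2 L M y)"
      using y by (simp add: f.map_top topmeet)
  qed (use y in \<open>auto simp: h_closed inj2_biideal\<close>)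
  ultimately show thesis using that[OF map] by blast
qed

end


subsection \<open>The induced relation\<close>

lemma induced_sublocale_set:
  assumes "frame X"
  shows "sublocale_set (coprod X X) {z. sim_saturated X u d z}"
proof -
  interpret frame_pair X X by (simp add: frame_pair_def assms)
  interpret T: frame T by (rule T_frame)
  let ?S = "{z. sim_saturated X u d z}"
  have rc: "p \<in> carrier T \<and> q \<in> carrier T" if "rect_sim X u d p q" for p q
    using that by (auto simp: rect_sim_def rect_biideal)
  show ?thesis
  proof unfold_locales
    show "?S \<subseteq> carrier T" by (auto simp: sim_saturated_def)
    show "\<Sqinter>\<^bsub>T\<^esub>A \<in> ?S" if A: "A \<subseteq> ?S" for A
    proof -
      have AT: "A \<subseteq> carrier T" using A by (auto simp: sim_saturated_def)
      have le: "w \<sqsubseteq>\<^bsub>T\<^esub> \<Sqinter>\<^bsub>T\<^esub>A \<longleftrightarrow> (\<forall>z\<in>A. w \<sqsubseteq>\<^bsub>T\<^esub> z)" if "w \<in> carrier T" for w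
        using AT that by (meson T.inf_closed T.inf_greatest T.inf_lower T.le_trans subsetD)
      have "p \<sqinter>\<^bsub>T\<^esub> w \<sqsubseteq>\<^bsub>T\<^esub> \<Sqinter>\<^bsub>T\<^esub>A \<longleftrightarrow> q \<sqinter>\<^bsub>T\<^esub> w \<sqsubseteq>\<^bsub>T\<^esub> \<Sqinter>\<^bsub>T\<^esub>A"
        if "rect_sim X u d p q" "w \<in> carrier T" for p q w
        using A that rc[OF that(1)] le[of "p \<sqinter>\<^bsub>T\<^esub> w"] le[of "q \<sqinter>\<^bsub>T\<^esub> w"] T.meet_closed
        unfolding sim_saturated_def by blast
      then show ?thesis using T.inf_closed[OF AT] unfolding sim_saturated_def by blast
    qed
    show "\<exists>i\<in>?S. \<forall>v\<in>carrier T. v \<sqsubseteq>\<^bsub>T\<^esub> i \<longleftrightarrow> v \<sqinter>\<^bsub>T\<^esub> w \<sqsubseteq>\<^bsub>T\<^esub> s"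
      if s: "s \<in> ?S" and w: "w \<in> carrier T" for s w
    proof -
      let ?I = "{v \<in> carrier T. v \<sqinter>\<^bsub>T\<^esub> w \<sqsubseteq>\<^bsub>T\<^esub> s}"
      let ?i = "\<Squnion>\<^bsub>T\<^esub>?I"
      have I: "?I \<subseteq> carrier T" by blast
      have sT: "s \<in> carrier T" using s unfolding sim_saturated_def by blast
      have iT: "?i \<in> carrier T" using T.sup_closed[OF I] .
      have wi: "w \<sqinter>\<^bsub>T\<^esub> ?i \<sqsubseteq>\<^bsub>T\<^esub> s"
        unfolding T.meet_sup_distrib[OF w I]
        by (rule T.sup_least) (use w sT T.meet_closed in \<open>auto simp: meet_comm[of T w]\<close>)
      have i: "v \<sqsubseteq>\<^bsub>T\<^esub> ?i \<longleftrightarrow> v \<sqinter>\<^bsub>T\<^esub> w \<sqsubseteq>\<^bsub>T\<^esub> s" if v: "v \<in> carrier T" for v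
      proof
        assume "v \<sqsubseteq>\<^bsub>T\<^esub> ?i"
        then have "v \<sqinter>\<^bsub>T\<^esub> w \<sqsubseteq>\<^bsub>T\<^esub> w \<sqinter>\<^bsub>T\<^esub> ?i"
          using v w iT by (meson T.le_trans T.meet_closed T.meet_le T.meet_left T.meet_right)
        then show "v \<sqinter>\<^bsub>T\<^esub> w \<sqsubseteq>\<^bsub>T\<^esub> s"
          using wi v w iT sT by (meson T.le_trans T.meet_closed)
      next
        assume "v \<sqinter>\<^bsub>T\<^esub> w \<sqsubseteq>\<^bsub>T\<^esub> s"
        then show "v \<sqsubseteq>\<^bsub>T\<^esub> ?i" using v by (intro T.sup_upper[OF I]) blast
      qed
      have assoc: "(p \<sqinter>\<^bsub>T\<^esub> v) \<sqinter>\<^bsub>T\<^esub> w = p \<sqinter>\<^bsub>T\<^esub> (v \<sqinter>\<^bsub>T\<^esub> w)"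
        if "p \<in> carrier T" "v \<in> carrier T" for p v
        using that w by (rule T.meet_assoc)
      have "sim_saturated X u d ?i"
        unfolding sim_saturated_def
      proof (intro conjI allI impI ballI)
        show "?i \<in> carrier T" by (fact iT)
        fix p q v assume pq: "rect_sim X u d p q" and v: "v \<in> carrier T"
        have pT: "p \<in> carrier T" and qT: "q \<in> carrier T" using rc[OF pq] by blast+
        have "p \<sqinter>\<^bsub>T\<^esub> v \<sqsubseteq>\<^bsub>T\<^esub> ?i \<longleftrightarrow> p \<sqinter>\<^bsub>T\<^esub> (v \<sqinter>\<^bsub>T\<^esub> w) \<sqsubseteq>\<^bsub>T\<^esub> s"
          by (rule i[OF T.meet_closed[OF pT v], unfolded assoc[OF pT v]])
        also have "\<dots> \<longleftrightarrow> q \<sqinter>\<^bsub>T\<^esub> (v \<sqinter>\<^bsub>T\<^esub> w) \<sqsubseteq>\<^bsub>T\<^esub> s"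
          using s pq T.meet_closed[OF v w] unfolding sim_saturated_def mem_Collect_eq by blast
        also have "\<dots> \<longleftrightarrow> q \<sqinter>\<^bsub>T\<^esub> v \<sqsubseteq>\<^bsub>T\<^esub> ?i"
          by (rule i[OF T.meet_closed[OF qT v], unfolded assoc[OF qT v], symmetric])
        finally show "p \<sqinter>\<^bsub>T\<^esub> v \<sqsubseteq>\<^bsub>T\<^esub> ?i \<longleftrightarrow> q \<sqinter>\<^bsub>T\<^esub> v \<sqsubseteq>\<^bsub>T\<^esub> ?i" .
      qed
      then show ?thesis by (intro bexI[of _ ?i]) (use i in simp_all)
    qed
  qed
qed

theorem induced_sublocale:
  assumes "frame X"
  shows "is_sublocale (coprod X X) (induced_rel X u d) (induced_map X u d)"
    and "w \<in> carrier (coprod X X) \<Longrightarrow> least (coprod X X) (induced_map X u d w)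
      {z. sim_saturated X u d z \<and> w \<sqsubseteq>\<^bsub>coprod X X\<^esub> z}"
proof -
  interpret S: sublocale_set "coprod X X" "{z. sim_saturated X u d z}"
    by (rule induced_sublocale_set[OF assms])
  have eq: "S.cl = induced_map X u d"
    by (rule ext) (simp add: S.cl_def induced_map_def)
  show "is_sublocale (coprod X X) (induced_rel X u d) (induced_map X u d)"
    using S.cl_sublocale by (simp add: eq induced_rel_def)
  show "least (coprod X X) (induced_map X u d w)
      {z. sim_saturated X u d z \<and> w \<sqsubseteq>\<^bsub>coprod X X\<^esub> z}" if "w \<in> carrier (coprod X X)"
    using S.cl_least[OF that] unfolding eq mem_Collect_eq .
qed


subsection \<open>The induced cones\<close>

lemma open_mapD:
  assumes "open_map R X f" "frame X"
  shows "frame_map X R f"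
    and "\<And>U. U \<in> carrier R \<Longrightarrow> left_adjoint X R f U \<in> carrier X"
    and "\<And>U V. U \<in> carrier R \<Longrightarrow> V \<in> carrier X \<Longrightarrow>
      left_adjoint X R f U \<sqsubseteq>\<^bsub>X\<^esub> V \<longleftrightarrow> U \<sqsubseteq>\<^bsub>R\<^esub> f V"
    and "\<And>U V. U \<in> carrier R \<Longrightarrow> V \<in> carrier X \<Longrightarrow>
      left_adjoint X R f (U \<sqinter>\<^bsub>R\<^esub> f V) = left_adjoint X R f U \<sqinter>\<^bsub>X\<^esub> V"
proof -
  show fm: "frame_map X R f" using assms(1) by (simp add: open_map_def)
  interpret frame_map X R f by fact
  obtain g where g: "galois_connection \<lparr>orderA = R, orderB = X, lower = g, upper = f\<rparr>"
    and fr: "\<forall>U\<in>carrier R. \<forall>V\<in>carrier X. g (U \<sqinter>\<^bsub>R\<^esub> f V) = g U \<sqinter>\<^bsub>X\<^esub> V"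
    using assms(1) by (auto simp: open_map_def)
  interpret g: galois_connection "\<lparr>orderA = R, orderB = X, lower = g, upper = f\<rparr>" by fact
  have eq: "left_adjoint X R f U = g U" if "U \<in> carrier R" for U
    using g.lower_by_complete_lattice[of U] that dom.complete_lattice_axioms
    by (simp add: left_adjoint_def)
  have gc: "U \<in> carrier R \<Longrightarrow> g U \<in> carrier X" for U using g.lower_closed[of U] by simp
  show "\<And>U. U \<in> carrier R \<Longrightarrow> left_adjoint X R f U \<in> carrier X" using eq gc by simp
  show "U \<in> carrier R \<Longrightarrow> V \<in> carrier X \<Longrightarrow>
      left_adjoint X R f U \<sqsubseteq>\<^bsub>X\<^esub> V \<longleftrightarrow> U \<sqsubseteq>\<^bsub>R\<^esub> f V" for U V
    using g.galois_property[of U V] eq by simp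
  show "U \<in> carrier R \<Longrightarrow> V \<in> carrier X \<Longrightarrow>
      left_adjoint X R f (U \<sqinter>\<^bsub>R\<^esub> f V) = left_adjoint X R f U \<sqinter>\<^bsub>X\<^esub> V" for U V
    using fr eq by simp
qed

theorem cones_parallel:
  assumes X: "frame X" and oc: "open_cones X R r"
  shows "parallel X (up_cone X R r) (down_cone X R r)"
    and "A \<subseteq> carrier X \<Longrightarrow> up_cone X R r (\<Squnion>\<^bsub>X\<^esub>A) = \<Squnion>\<^bsub>X\<^esub>(up_cone X R r ` A)"
    and "A \<subseteq> carrier X \<Longrightarrow> down_cone X R r (\<Squnion>\<^bsub>X\<^esub>A) = \<Squnion>\<^bsub>X\<^esub>(down_cone X R r ` A)"
proof -
  define s t where "s = source X r" and "t = target X r"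
  have os: "open_map R X s" and ot: "open_map R X t"
    using oc by (auto simp: open_cones_def s_def t_def)
  have gen: "left_adjoint X R g (f (\<Squnion>\<^bsub>X\<^esub>A)) = \<Squnion>\<^bsub>X\<^esub>((left_adjoint X R g \<circ> f) ` A)"
    if fg: "open_map R X f" "open_map R X g" and A: "A \<subseteq> carrier X" for f g A
  proof -
    note F = open_mapD[OF fg(1) X] and G = open_mapD[OF fg(2) X]
    interpret f: frame_map X R f by (rule F(1))
    interpret g: frame_map X R g by (rule G(1))
    have [simp]: "x \<in> A \<Longrightarrow> x \<in> carrier X" for x using A by auto
    have fA: "f ` A \<subseteq> carrier R" using A by auto
    show ?thesis
    proof (rule f.dom.sup_eqI[symmetric])
      show "(left_adjoint X R g \<circ> f) ` A \<subseteq> carrier X" by (auto simp: G(2))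
      show "left_adjoint X R g (f (\<Squnion>\<^bsub>X\<^esub>A)) \<in> carrier X" using A by (simp add: G(2))
      show "y \<sqsubseteq>\<^bsub>X\<^esub> left_adjoint X R g (f (\<Squnion>\<^bsub>X\<^esub>A))" if y: "y \<in> (left_adjoint X R g \<circ> f) ` A" for y
      proof -
        obtain a where a: "a \<in> A" "y = left_adjoint X R g (f a)" using y by auto
        have m: "left_adjoint X R g (f (\<Squnion>\<^bsub>X\<^esub>A)) \<in> carrier X" using A by (simp add: G(2))
        have "f (\<Squnion>\<^bsub>X\<^esub>A) \<sqsubseteq>\<^bsub>R\<^esub> g (left_adjoint X R g (f (\<Squnion>\<^bsub>X\<^esub>A)))"
          using G(3)[of "f (\<Squnion>\<^bsub>X\<^esub>A)", OF _ m] A m by simp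
        moreover have "f a \<sqsubseteq>\<^bsub>R\<^esub> f (\<Squnion>\<^bsub>X\<^esub>A)"
          using A a by (intro f.mono f.dom.sup_upper) auto
        ultimately have "f a \<sqsubseteq>\<^bsub>R\<^esub> g (left_adjoint X R g (f (\<Squnion>\<^bsub>X\<^esub>A)))"
          using f.cod.le_trans[of "f a" "f (\<Squnion>\<^bsub>X\<^esub>A)"
              "g (left_adjoint X R g (f (\<Squnion>\<^bsub>X\<^esub>A)))"] A a m by simp
        then show ?thesis using G(3)[of "f a", OF _ m] a by simp
      qed
      show "left_adjoint X R g (f (\<Squnion>\<^bsub>X\<^esub>A)) \<sqsubseteq>\<^bsub>X\<^esub> w"
        if w: "w \<in> carrier X" "\<And>y. y \<in> (left_adjoint X R g \<circ> f) ` A \<Longrightarrow> y \<sqsubseteq>\<^bsub>X\<^esub> w" for w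
      proof -
        have "f a \<sqsubseteq>\<^bsub>R\<^esub> g w" if "a \<in> A" for a
          using w(2)[of "left_adjoint X R g (f a)"] that w(1) by (simp add: G(3))
        then have "\<Squnion>\<^bsub>R\<^esub>(f ` A) \<sqsubseteq>\<^bsub>R\<^esub> g w" using fA w(1) by (simp add: f.cod.sup_le_iff)
        then have "f (\<Squnion>\<^bsub>X\<^esub>A) \<sqsubseteq>\<^bsub>R\<^esub> g w" using A by (simp add: f.map_sup)
        then show ?thesis using A w(1) by (simp add: G(3))
      qed
    qed
  qed
  show "A \<subseteq> carrier X \<Longrightarrow> up_cone X R r (\<Squnion>\<^bsub>X\<^esub>A) = \<Squnion>\<^bsub>X\<^esub>(up_cone X R r ` A)"
    using gen[OF os ot] by (simp add: up_cone_def s_def t_def)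
  show "A \<subseteq> carrier X \<Longrightarrow> down_cone X R r (\<Squnion>\<^bsub>X\<^esub>A) = \<Squnion>\<^bsub>X\<^esub>(down_cone X R r ` A)"
    using gen[OF ot os] by (simp add: down_cone_def s_def t_def)
  have par: "left_adjoint X R g (f x) \<sqinter>\<^bsub>X\<^esub> y \<sqsubseteq>\<^bsub>X\<^esub>
      left_adjoint X R g (f (x \<sqinter>\<^bsub>X\<^esub> left_adjoint X R f (g y)))"
    if fg: "open_map R X f" "open_map R X g" and xy: "x \<in> carrier X" "y \<in> carrier X" for f g x y
  proof -
    note F = open_mapD[OF fg(1) X] and G = open_mapD[OF fg(2) X]
    interpret f: frame_map X R f by (rule F(1))
    interpret g: frame_map X R g by (rule G(1))
    let ?d = "left_adjoint X R f (g y)"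
    have d: "?d \<in> carrier X" "g y \<sqsubseteq>\<^bsub>R\<^esub> f ?d"
      using xy F(3)[of "g y" ?d] by (simp_all add: F(2))
    let ?z = "left_adjoint X R g (f (x \<sqinter>\<^bsub>X\<^esub> ?d))"
    have z: "?z \<in> carrier X" "f (x \<sqinter>\<^bsub>X\<^esub> ?d) \<sqsubseteq>\<^bsub>R\<^esub> g ?z"
      using xy d G(3)[of "f (x \<sqinter>\<^bsub>X\<^esub> ?d)" ?z] by (simp_all add: G(2))
    have "f x \<sqinter>\<^bsub>R\<^esub> g y \<sqsubseteq>\<^bsub>R\<^esub> f x \<sqinter>\<^bsub>R\<^esub> f ?d"
      using xy d by (meson f.closed g.closed f.cod.le_trans f.cod.meet_closed f.cod.meet_le
          f.cod.meet_left f.cod.meet_right)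
    then have "f x \<sqinter>\<^bsub>R\<^esub> g y \<sqsubseteq>\<^bsub>R\<^esub> g ?z"
      by (rule f.cod.le_trans) (use xy d z in \<open>simp_all add: f.map_meet\<close>)
    then show ?thesis using xy z by (simp add: G(3) G(4)[symmetric])
  qed
  show "parallel X (up_cone X R r) (down_cone X R r)"
    unfolding parallel_def
    using par[OF os ot] par[OF ot os]
    by (simp add: up_cone_def down_cone_def s_def t_def meet_comm[of X])
qed

end

theory Submission
  imports Defs
begin

text \<open>
  The left adjoints of \<open>s\<close> and \<open>t\<close> send \<open>r (a \<otimes> b)\<close> to \<open>a \<sqinter> d b\<close> and \<open>u a \<sqinter> b\<close>, and these two images
  determine \<open>r (a \<otimes> b)\<close>, so \<open>r\<close> identifies \<open>\<sim>\<close>-related rectangles. Hence \<open>R\<close> is contained in the induced relation.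
  This inclusion is strongly dense: a rectangle that \<open>r\<close> sends to bottom is \<open>\<sim>\<close>-related to the
  empty rectangle. Weak closedness then makes the inclusion an isomorphism.
\<close>

context sublocale_set
begin

text \<open>Since \<open>w \<sqsubseteq> right_adjoint L M r (r w)\<close> and the right side lies
  in \<open>S\<close>, also \<open>cl w\<close> is below it, so \<open>r\<close> cannot tell
  \<open>w\<close> from \<open>cl w\<close>. Joins in \<open>N\<close> are closures of joins in
  \<open>L\<close>, while finite meets agree, so \<open>r\<close> stays a frame map on
  \<open>N\<close>.\<close>

lemma factor_through_cl:
  assumes r: "frame_map L M r"
    and in_S: "\<And>y. y \<in> carrier M \<Longrightarrow> right_adjoint L M r y \<in> S"
  shows "frame_map N M r" and "w \<in> carrier L \<Longrightarrow> r (cl w) = r w"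
proof -
  interpret r: frame_map L M r by fact
  interpret N: frame N by (rule N_frame)
  show r_cl: "r (cl w) = r w" if w: "w \<in> carrier L" for w
  proof (rule r.cod.le_antisym)
    have "w \<sqsubseteq> right_adjoint L M r (r w)"
      using w by (simp add: r.right_adjoint[symmetric])
    then have "cl w \<sqsubseteq> right_adjoint L M r (r w)" using w by (simp add: cl_le_iff in_S)
    then show "r (cl w) \<sqsubseteq>\<^bsub>M\<^esub> r w" using w by (simp add: r.right_adjoint)
    show "r w \<sqsubseteq>\<^bsub>M\<^esub> r (cl w)" using w by (intro r.mono le_cl) simp_all
  qed (use w in simp_all)
  show "frame_map N M r"
  proof (rule frame_mapI)
    have "\<top>\<^bsub>N\<^esub> = \<top>" by (rule N.top_eq[symmetric]) (auto simp: top_in)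
    then show "r \<top>\<^bsub>N\<^esub> = \<top>\<^bsub>M\<^esub>" by (simp add: r.map_top)
    show "r (\<Squnion>\<^bsub>N\<^esub>A) = \<Squnion>\<^bsub>M\<^esub>(r ` A)" if "A \<subseteq> carrier N" for A
    proof -
      have A: "A \<subseteq> S" "A \<subseteq> carrier L" using that by auto
      then show ?thesis by (simp add: N_sup r_cl r.map_sup)
    qed
  qed (auto simp: N_frame r.cod.frame_axioms N_meet r.map_meet)
qed

end

locale open_cone_relation =
  fixes X :: "'a gorder" and R :: "'r gorder" and r :: "('a \<times> 'a) set \<Rightarrow> 'r"
  assumes frame_X: "frame X"
    and relation: "localic_relation X R r"
    and cones: "open_cones X R r"
begin

abbreviation "s \<equiv> source X r"
abbreviation "t \<equiv> target X r"
abbreviation "s\<^sub>l \<equiv> left_adjoint X R s"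
abbreviation "t\<^sub>l \<equiv> left_adjoint X R t"
abbreviation "u \<equiv> up_cone X R r"
abbreviation "d \<equiv> down_cone X R r"

sublocale frame_pair X X by (simp add: frame_pair_def frame_X)

sublocale T: frame "coprod X X" by (rule T_frame)

sublocale r: frame_map "coprod X X" R r
  using relation by (simp add: localic_relation_def is_sublocale_def)

lemmas open_s = open_mapD[OF conjunct1[OF cones[unfolded open_cones_def]] frame_X]
lemmas open_t = open_mapD[OF conjunct2[OF cones[unfolded open_cones_def]] frame_X]

sublocale s: frame_map X R s by (rule open_s(1))

sublocale t: frame_map X R t by (rule open_t(1))

lemma r_rect:
  assumes "a \<in> carrier X" "b \<in> carrier X"
  shows "r (rect X X a b) = s a \<sqinter>\<^bsub>R\<^esub> t b"
  using assms
  by (simp add: rect_def r.map_meet inj1_biideal inj2_biideal source_def target_def)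

text \<open>Frobenius reciprocity for \<open>t\<^sub>l\<close> and \<open>s\<^sub>l\<close>, applied
  to \<open>s a \<sqinter> t b\<close>. The two equations defining \<open>rect_sim\<close> thus say
  that the images of the rectangles under \<open>r\<close> agree under both left adjoints.\<close>

lemma left_adjoint_rect:
  assumes "a \<in> carrier X" "b \<in> carrier X"
  shows "t\<^sub>l (r (rect X X a b)) = u a \<sqinter>\<^bsub>X\<^esub> b" and "s\<^sub>l (r (rect X X a b)) = a \<sqinter>\<^bsub>X\<^esub> d b"
  using assms open_t(4)[of "s a" b] open_s(4)[of "t b" a]
  by (simp_all add: r_rect up_cone_def down_cone_def meet_comm[of R "s a"] meet_comm[of X a])

lemma r_rect_le_iff:
  assumes "p \<in> carrier R" "a \<in> carrier X" "b \<in> carrier X"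
  shows "p \<sqsubseteq>\<^bsub>R\<^esub> r (rect X X a b) \<longleftrightarrow> s\<^sub>l p \<sqsubseteq>\<^bsub>X\<^esub> a \<and> t\<^sub>l p \<sqsubseteq>\<^bsub>X\<^esub> b"
  using assms by (simp add: r_rect r.cod.meet_le_iff open_s(3) open_t(3))

lemma r_rect_sim:
  assumes "rect_sim X u d p q"
  shows "r p = r q"
proof -
  \<comment> \<open>The test for lying below \<open>r (rect X X c e)\<close> sees an element only
    through \<open>s\<^sub>l\<close> and \<open>t\<^sub>l\<close>. By reflexivity
    \<open>r (rect X X c e)\<close> passes it, hence so does any element with the same two
    values.\<close>
  have le: "r (rect X X a b) \<sqsubseteq>\<^bsub>R\<^esub> r (rect X X c e)"
    if "a \<in> carrier X" "b \<in> carrier X" "c \<in> carrier X" "e \<in> carrier X"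
      "s\<^sub>l (r (rect X X a b)) = s\<^sub>l (r (rect X X c e))"
      "t\<^sub>l (r (rect X X a b)) = t\<^sub>l (r (rect X X c e))" for a b c e
    using that r_rect_le_iff[of "r (rect X X c e)" c e]
    by (simp add: r_rect_le_iff rect_biideal)
  obtain a b c e where *: "a \<in> carrier X" "b \<in> carrier X" "c \<in> carrier X" "e \<in> carrier X"
    "p = rect X X a b" "q = rect X X c e"
    "s\<^sub>l (r p) = s\<^sub>l (r q)" "t\<^sub>l (r p) = t\<^sub>l (r q)"
    using assms by (auto simp: rect_sim_def left_adjoint_rect)
  show ?thesis
    by (rule r.cod.le_antisym) (use * le in \<open>simp_all add: rect_biideal\<close>)
qed

text \<open>Transposed along the adjunction, saturation asks that \<open>r\<close> identify
  \<open>p \<sqinter> w\<close> with \<open>q \<sqinter> w\<close> whenever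
  \<open>p \<sim> q\<close>. This follows from \<open>r p = r q\<close>, as \<open>r\<close>
  preserves meets.\<close>

lemma right_adjoint_saturated:
  assumes "y \<in> carrier R"
  shows "sim_saturated X u d (right_adjoint (coprod X X) R r y)"
  unfolding sim_saturated_def
proof (intro conjI allI impI ballI)
  show "right_adjoint (coprod X X) R r y \<in> carrier (coprod X X)"
    unfolding right_adjoint_def by (rule T.sup_closed) auto
  fix p q w assume pq: "rect_sim X u d p q" and w: "w \<in> carrier (coprod X X)"
  have c: "p \<in> carrier (coprod X X)" "q \<in> carrier (coprod X X)"
    using pq by (auto simp: rect_sim_def rect_biideal)
  have "r (p \<sqinter>\<^bsub>coprod X X\<^esub> w) = r (q \<sqinter>\<^bsub>coprod X X\<^esub> w)"
    using r_rect_sim[OF pq] c w by (simp only: r.map_meet)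
  then show "p \<sqinter>\<^bsub>coprod X X\<^esub> w \<sqsubseteq>\<^bsub>coprod X X\<^esub> right_adjoint (coprod X X) R r y \<longleftrightarrow>
      q \<sqinter>\<^bsub>coprod X X\<^esub> w \<sqsubseteq>\<^bsub>coprod X X\<^esub> right_adjoint (coprod X X) R r y"
    using r.right_adjoint[OF T.meet_closed[OF c(1) w] assms]
      r.right_adjoint[OF T.meet_closed[OF c(2) w] assms] by simp
qed

sublocale S: sublocale_set "coprod X X" "{z. sim_saturated X u d z}"
  by (rule induced_sublocale_set[OF frame_X])

lemma cl_eq: "S.cl = induced_map X u d"
  by (rule ext) (simp add: S.cl_def induced_map_def)

text \<open>The factorisation is given by \<open>r\<close> itself, restricted to saturated elements,
  because \<open>r\<close> takes the same value at an open and at its saturation.\<close>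

lemma inclusion:
  "sublocale_inclusion (coprod X X) R r (induced_rel X u d) (induced_map X u d) r"
  using S.factor_through_cl[OF r.frame_map_axioms] right_adjoint_saturated
    induced_sublocale(1)[OF frame_X] relation
  by (simp add: sublocale_inclusion_def localic_relation_def cl_eq induced_rel_def)

text \<open>The given rectangle and \<open>\<bottom> \<otimes> \<bottom>\<close> have the same image
  under \<open>r\<close>, so by \<open>left_adjoint_rect\<close> they are
  \<open>\<sim>\<close>-related; the latter lies below every saturated element.\<close>

lemma empty_rect_le_saturated:
  assumes z: "sim_saturated X u d z" and ab: "a \<in> carrier X" "b \<in> carrier X"
    and bot: "r (rect X X a b) = \<bottom>\<^bsub>R\<^esub>"
  shows "rect X X a b \<subseteq> z"
proof -
  let ?o = "rect X X \<bottom>\<^bsub>X\<^esub> \<bottom>\<^bsub>X\<^esub>"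
  have zc: "biideal X X z" using z by (simp add: sim_saturated_def)
  have "r ?o = \<bottom>\<^bsub>R\<^esub>"
    using r.cod.meet_left[of "\<bottom>\<^bsub>R\<^esub>" "\<bottom>\<^bsub>R\<^esub>"]
    by (intro r.cod.le_antisym) (simp_all add: r_rect s.map_bottom t.map_bottom)
  then have "rect_sim X u d (rect X X a b) ?o"
    unfolding rect_sim_def using ab bot by (metis L.bottom_closed left_adjoint_rect)
  \<comment> \<open>Saturation is tested with \<open>w\<close> the rectangle itself, so that the
    left side reduces to the goal.\<close>
  then have "rect X X a b \<sqinter>\<^bsub>coprod X X\<^esub> rect X X a b \<sqsubseteq>\<^bsub>coprod X X\<^esub> z \<longleftrightarrow>
      ?o \<sqinter>\<^bsub>coprod X X\<^esub> rect X X a b \<sqsubseteq>\<^bsub>coprod X X\<^esub> z"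
    using z ab rect_biideal unfolding sim_saturated_def by (metis (no_types, lifting) carrier_T mem_Collect_eq)
  moreover have "?o \<subseteq> z" using zc by (simp add: rect_le_iff bottom_mem)
  ultimately show ?thesis using ab by (auto simp: T_meet rect_biideal)
qed

text \<open>For true \<open>p\<close> the bound is the top element. For false \<open>p\<close> it is
  the least saturated element, and every rectangle inside \<open>z\<close> has bottom image under
  \<open>r\<close>, hence lies below it.\<close>

lemma inclusion_strongly_dense: "strongly_dense R (induced_rel X u d) r"
proof -
  let ?N = "induced_rel X u d"
  interpret g: frame_map ?N R r using inclusion by (simp add: sublocale_inclusion_def)
  have N: "z \<in> carrier ?N \<longleftrightarrow> sim_saturated X u d z" "x \<sqsubseteq>\<^bsub>?N\<^esub> y \<longleftrightarrow> x \<subseteq> y" for x y z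
    by (simp_all add: induced_rel_def)
  have bang_c: "bang ?N p \<in> carrier ?N" for p
    unfolding bang_def by (rule g.dom.sup_closed) auto
  have "z \<sqsubseteq>\<^bsub>?N\<^esub> bang ?N p" if z: "z \<in> carrier ?N" and le: "r z \<sqsubseteq>\<^bsub>R\<^esub> bang R p" for z p
  proof (cases p)
    case True
    then have "{x. x = \<top>\<^bsub>?N\<^esub> \<and> p} = {\<top>\<^bsub>?N\<^esub>}" by auto
    then have "\<top>\<^bsub>?N\<^esub> \<sqsubseteq>\<^bsub>?N\<^esub> bang ?N p"
      unfolding bang_def by (intro g.dom.sup_upper) auto
    then show ?thesis
      using z bang_c g.dom.le_trans[of z "\<top>\<^bsub>?N\<^esub>" "bang ?N p"] by simp
  next
    case False
    have zc: "biideal X X z" using z by (simp add: N sim_saturated_def)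
    have "bang R p \<sqsubseteq>\<^bsub>R\<^esub> \<bottom>\<^bsub>R\<^esub>"
      unfolding bang_def by (rule r.cod.sup_least) (use False in auto)
    moreover have "bang R p \<in> carrier R"
      unfolding bang_def by (rule r.cod.sup_closed) auto
    ultimately have rz: "r z \<sqsubseteq>\<^bsub>R\<^esub> \<bottom>\<^bsub>R\<^esub>"
      using le zc r.cod.le_trans[of "r z" "bang R p" "\<bottom>\<^bsub>R\<^esub>"] by simp
    have "(a, b) \<in> bang ?N p" if ab: "(a, b) \<in> z" for a b
    proof -
      have c: "a \<in> carrier X" "b \<in> carrier X" using biidealD(1,2)[OF zc ab] .
      have "r (rect X X a b) \<sqsubseteq>\<^bsub>R\<^esub> r z"
        using c ab zc by (intro r.mono) (simp_all add: rect_biideal rect_le_iff)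
      then have "r (rect X X a b) \<sqsubseteq>\<^bsub>R\<^esub> \<bottom>\<^bsub>R\<^esub>"
        using rz c zc r.cod.le_trans[of "r (rect X X a b)" "r z" "\<bottom>\<^bsub>R\<^esub>"]
        by (simp add: rect_biideal)
      then have "r (rect X X a b) = \<bottom>\<^bsub>R\<^esub>"
        using c by (intro r.cod.le_antisym) (simp_all add: rect_biideal)
      then have "rect X X a b \<subseteq> bang ?N p"
        using bang_c c by (intro empty_rect_le_saturated) (simp_all add: N)
      then show ?thesis using bang_c c by (simp add: N sim_saturated_def rect_le_iff)
    qed
    then show ?thesis by (auto simp: N)
  qed
  then show ?thesis by (simp add: strongly_dense_alt g.frame_map_axioms)
qed

end

theorem corollary9p21:
  fixes X :: "'a gorder" and R :: "'r gorder" and r :: "('a \<times> 'a) set \<Rightarrow> 'r"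
  assumes "frame X"
    and "localic_relation X R r"
    and "open_cones X R r"
    and "weakly_closed (coprod X X) R r"
  shows "sublocale_iso (coprod X X) R r
           (induced_rel X (up_cone X R r) (down_cone X R r))
           (induced_map X (up_cone X R r) (down_cone X R r))"
proof -
  interpret open_cone_relation X R r using assms by (simp add: open_cone_relation_def)
  show ?thesis
    \<comment> \<open>The induced relation is carried by a set of opens of
      \<open>coprod X X\<close>, so it has the type over which the test sublocales of
      \<open>weakly_closed\<close> range.\<close>
    using inclusion inclusion_strongly_dense assms(4)
    unfolding sublocale_iso_def weakly_closed_def by blast
qed

end
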